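(* The bilinear maps $\langle\cdot,\cdot\rangle_T:C_T(\mathbb{R},X^\star)\times C_T(\mathbb{R},X)\to\mathbb{C}$ and $\langle\cdot,\cdot\rangle_T:C_T(\mathbb{R},X^{\odot\star})\times C_T(\mathbb{R},X^\odot)\to\mathbb{C}$ defined by $$\langle\varphi^\star,\varphi\rangle_T=\int_0^T\langle\varphi^\star(\tau),\varphi(\tau)\rangle\,d\tau,\qquad \langle\varphi^{\odot\star},\varphi^\odot\rangle_T=\int_0^T\langle\varphi^{\odot\star}(\tau),\varphi^\odot(\tau)\rangle\,d\tau$$ are nondegenerate, i.e. for each of the two pairings the linear maps sending an element of the first space to the functional it induces on the second, and an element of the second space to the functional it induces on the first, are injective.
   Context: Fix $0<h<\infty$, $T>0$, $n\ge1$ and $X=C([-h,0],\mathbb{R}^n)$ with the supremum norm. $\mathbb{R}^{n\star}$ denotes row vectors. $X^\star\cong NBV([0,h],\mathbb{R}^{n\star})$ is the dual of $X$ (functions of bounded variation, zero at $0$, right-continuous on $(0,h)$, with $\langle f,\varphi\rangle=\int_0^h df(\theta)\varphi(-\theta)$). $X^\odot\cong\mathbb{R}^{n\star}\times L^1([0,h],\mathbb{R}^{n\star})$ is the sun dual of $X$ with respect to the shift semigroup, the closed subspace of $X^\star$ in which $(c,g)$ is identified with the function $f$ with $f(0)=0$, $f(\theta)=c+\int_0^\theta g$ for $\theta\in(0,h]$. $X^{\odot\star}\cong\mathbb{R}^n\times L^\infty([-h,0],\mathbb{R}^n)$ is its dual, with pairing $\langle(a,\psi),(c,g)\rangle=ca+\int_0^hg(\theta)\psi(-\theta)\,d\theta$.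 All spaces and (bilinear) pairings are complexified without change of notation. For a complex Banach space $E$, $C_T(\mathbb{R},E)$ is the Banach space of continuous $T$-periodic functions $\mathbb{R}\to E$ with the supremum norm. *)

theory Defs
  imports "HOL-Probability.Essential_Supremum" "HOL-Library.Function_Algebras"
begin

text \<open>
  Everything is complexified, so vectors have entries in \<open>complex\<close>. Columns and rows
  both have type \<open>complex ^ 'n\<close>; the product of a row with a column is \<open>row_mult\<close>, which
  involves no complex conjugation.

  The spaces depend on the number \<open>h\<close>, so each of them is a pair of a carrier set of representing
  functions (or pairs) and a seminorm. Two representatives denote the same element iff the seminorm
  of their difference is zero (\<open>same_elem\<close>): for \<open>X\<close> and \<open>NBV\<close> this is equality on the interval in
  question, for \<open>L\<^sup>1\<close> and \<open>L\<^sup>\<infinity>\<close> it is equality almost everywhere there.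
\<close>

class complex_module = ab_group_add +
  fixes scaleC :: "complex \<Rightarrow> 'a \<Rightarrow> 'a" (infixr "*\<^sub>C" 75)
  assumes scaleC_add_right: "a *\<^sub>C (x + y) = a *\<^sub>C x + a *\<^sub>C y"
    and scaleC_add_left: "(a + b) *\<^sub>C x = a *\<^sub>C x + b *\<^sub>C x"
    and scaleC_scaleC: "a *\<^sub>C (b *\<^sub>C x) = (a * b) *\<^sub>C x"
    and scaleC_one: "1 *\<^sub>C x = x"

instantiation complex :: complex_module
begin
definition "scaleC a (x::complex) = a * x"
instance by standard (simp_all add: scaleC_complex_def algebra_simps)
end

instantiation vec :: (complex_module, finite) complex_module
begin
definition "scaleC a (x::'a^'b) = (\<chi> i. a *\<^sub>C (x $ i))"
instance
  by standard (simp_all add: scaleC_vec_def vec_eq_iff scaleC_add_right scaleC_add_left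
      scaleC_scaleC scaleC_one)
end

instantiation "fun" :: (type, complex_module) complex_module
begin
definition "scaleC a (f::'a \<Rightarrow> 'b) = (\<lambda>x. a *\<^sub>C f x)"
instance
  by standard (simp_all add: scaleC_fun_def fun_eq_iff scaleC_add_right scaleC_add_left
      scaleC_scaleC scaleC_one)
end

instantiation prod :: (complex_module, complex_module) complex_module
begin
definition "scaleC a (x::'a \<times> 'b) = (a *\<^sub>C fst x, a *\<^sub>C snd x)"
instance
  by standard (simp_all add: scaleC_prod_def prod_eq_iff scaleC_add_right scaleC_add_left
      scaleC_scaleC scaleC_one)
end

definition row_mult :: "complex ^ 'n \<Rightarrow> complex ^ 'n \<Rightarrow> complex" where
  "row_mult c a = (\<Sum>i\<in>UNIV. c $ i * a $ i)"

definition X_space :: "real \<Rightarrow> (real \<Rightarrow> complex ^ 'n) set" where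
  "X_space h = {\<phi>. continuous_on {-h..0} \<phi>}"

definition X_norm :: "real \<Rightarrow> (real \<Rightarrow> complex ^ 'n) \<Rightarrow> real" where
  "X_norm h \<phi> = (SUP \<theta>\<in>{-h..0}. norm (\<phi> \<theta>))"

definition variation_sums :: "real \<Rightarrow> real \<Rightarrow> (real \<Rightarrow> 'a::real_normed_vector) \<Rightarrow> real set" where
  "variation_sums a b f =
     (\<lambda>d. \<Sum>K\<in>d. norm (f (Sup K) - f (Inf K))) ` {d. d division_of {a..b}}"

text \<open>
  The dual of \<open>X\<close> is represented by the space \<open>NBV\<close> of normalized functions of bounded variation,
  with the total variation as norm. Right continuity is not required at 0 and at \<open>h\<close>.
\<close>

definition Xstar_space :: "real \<Rightarrow> (real \<Rightarrow> complex ^ 'n) set" where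
  "Xstar_space h = {f. bdd_above (variation_sums 0 h f) \<and> f 0 = 0 \<and>
     (\<forall>\<theta>\<in>{0<..<h}. continuous (at_right \<theta>) f)}"

definition Xstar_norm :: "real \<Rightarrow> (real \<Rightarrow> complex ^ 'n) \<Rightarrow> real" where
  "Xstar_norm h f = Sup (variation_sums 0 h f)"

text \<open>
  Riemann--Stieltjes integral of \<open>\<phi>(-\<theta>)\<close> against \<open>df(\<theta>)\<close> over \<open>{0..h}\<close>, as the limit of the
  Riemann--Stieltjes sums as the mesh tends to zero (fineness with respect to balls of
  constant radius). A jump of \<open>f\<close> at 0 contributes to the integral.
\<close>

definition has_stieltjes_pairing ::
  "real \<Rightarrow> (real \<Rightarrow> complex ^ 'n) \<Rightarrow> (real \<Rightarrow> complex ^ 'n) \<Rightarrow> complex \<Rightarrow> bool" where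
  "has_stieltjes_pairing h f \<phi> I \<longleftrightarrow>
     (\<forall>e>0. \<exists>d>0. \<forall>p. p tagged_division_of {0..h} \<and> (\<lambda>x. ball x d) fine p \<longrightarrow>
        norm ((\<Sum>(x, K)\<in>p. row_mult (f (Sup K) - f (Inf K)) (\<phi> (- x))) - I) < e)"

definition Xstar_pairing :: "real \<Rightarrow> (real \<Rightarrow> complex ^ 'n) \<Rightarrow> (real \<Rightarrow> complex ^ 'n) \<Rightarrow> complex" where
  "Xstar_pairing h f \<phi> = (THE I. has_stieltjes_pairing h f \<phi> I)"

text \<open>
  The norm on pairs \<open>(c, g)\<close> is the total variation of the function that vanishes at 0 and
  equals \<open>c\<close> plus the indefinite integral of \<open>g\<close> elsewhere; this is the norm inherited from the
  dual of \<open>X\<close>. The norm on pairs \<open>(a, \<psi>)\<close> is the corresponding dual norm.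
\<close>

definition Xsun_space :: "real \<Rightarrow> ((complex ^ 'n) \<times> (real \<Rightarrow> complex ^ 'n)) set" where
  "Xsun_space h = {(c, g). g absolutely_integrable_on {0..h}}"

definition Xsun_norm :: "real \<Rightarrow> (complex ^ 'n) \<times> (real \<Rightarrow> complex ^ 'n) \<Rightarrow> real" where
  "Xsun_norm h = (\<lambda>(c, g). norm c + integral {0..h} (\<lambda>\<theta>. norm (g \<theta>)))"

definition essnorm :: "real \<Rightarrow> (real \<Rightarrow> complex ^ 'n) \<Rightarrow> ereal" where
  "essnorm h \<psi> = esssup (lebesgue_on {-h..0}) (\<lambda>\<theta>. ereal (norm (\<psi> \<theta>)))"

definition Xsunstar_space :: "real \<Rightarrow> ((complex ^ 'n) \<times> (real \<Rightarrow> complex ^ 'n)) set" where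
  "Xsunstar_space h =
     {(a, \<psi>). \<psi> \<in> borel_measurable (lebesgue_on {-h..0}) \<and> essnorm h \<psi> < \<infinity>}"

definition Xsunstar_norm :: "real \<Rightarrow> (complex ^ 'n) \<times> (real \<Rightarrow> complex ^ 'n) \<Rightarrow> real" where
  "Xsunstar_norm h = (\<lambda>(a, \<psi>). max (norm a) (real_of_ereal (essnorm h \<psi>)))"

definition Xsunstar_pairing ::
  "real \<Rightarrow> (complex ^ 'n) \<times> (real \<Rightarrow> complex ^ 'n) \<Rightarrow> (complex ^ 'n) \<times> (real \<Rightarrow> complex ^ 'n) \<Rightarrow> complex"
  where
  "Xsunstar_pairing h = (\<lambda>(a, \<psi>) (c, g).
     row_mult c a + integral {0..h} (\<lambda>\<theta>. row_mult (g \<theta>) (\<psi> (- \<theta>))))"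

definition same_elem :: "('e::complex_module \<Rightarrow> real) \<Rightarrow> 'e \<Rightarrow> 'e \<Rightarrow> bool" where
  "same_elem nrm x y \<longleftrightarrow> nrm (x - y) = 0"

definition C_per :: "real \<Rightarrow> 'e::complex_module set \<Rightarrow> ('e \<Rightarrow> real) \<Rightarrow> (real \<Rightarrow> 'e) set" where
  "C_per T E nrm = {u. (\<forall>t. u t \<in> E) \<and> (\<forall>t. same_elem nrm (u (t + T)) (u t)) \<and>
     (\<forall>t. ((\<lambda>s. nrm (u s - u t)) \<longlongrightarrow> 0) (at t))}"

definition same_fun :: "('e::complex_module \<Rightarrow> real) \<Rightarrow> (real \<Rightarrow> 'e) \<Rightarrow> (real \<Rightarrow> 'e) \<Rightarrow> bool" where
  "same_fun nrm u v \<longleftrightarrow> (\<forall>t. same_elem nrm (u t) (v t))"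

definition pairing_T :: "real \<Rightarrow> ('a \<Rightarrow> 'b \<Rightarrow> complex) \<Rightarrow> (real \<Rightarrow> 'a) \<Rightarrow> (real \<Rightarrow> 'b) \<Rightarrow> complex" where
  "pairing_T T b u v = integral {0..T} (\<lambda>\<tau>. b (u \<tau>) (v \<tau>))"

definition bilinear_form_on ::
  "'a::complex_module set \<Rightarrow> 'b::complex_module set \<Rightarrow> ('a \<Rightarrow> 'b \<Rightarrow> complex) \<Rightarrow> bool" where
  "bilinear_form_on E F B \<longleftrightarrow>
     (\<forall>x\<in>E. \<forall>x'\<in>E. \<forall>y\<in>F. B (x + x') y = B x y + B x' y) \<and>
     (\<forall>x\<in>E. \<forall>y\<in>F. \<forall>y'\<in>F. B x (y + y') = B x y + B x y') \<and>
     (\<forall>a. \<forall>x\<in>E. \<forall>y\<in>F. B (a *\<^sub>C x) y = a * B x y \<and> B x (a *\<^sub>C y) = a * B x y)"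

text \<open>
  Here \<open>eqE\<close> and \<open>eqF\<close> say when two representatives denote the same element. In each equivalence
  the left-to-right direction is injectivity of the map to functionals; the other one says that
  this map does not depend on the choice of representatives.
\<close>

definition nondegenerate_on ::
  "'a::complex_module set \<Rightarrow> ('a \<Rightarrow> 'a \<Rightarrow> bool) \<Rightarrow> 'b::complex_module set \<Rightarrow> ('b \<Rightarrow> 'b \<Rightarrow> bool) \<Rightarrow>
    ('a \<Rightarrow> 'b \<Rightarrow> complex) \<Rightarrow> bool" where
  "nondegenerate_on E eqE F eqF B \<longleftrightarrow>
     (\<forall>x\<in>E. \<forall>x'\<in>E. (\<forall>y\<in>F. B x y = B x' y) \<longleftrightarrow> eqE x x') \<and>
     (\<forall>y\<in>F. \<forall>y'\<in>F. (\<forall>x\<in>E. B x y = B x y') \<longleftrightarrow> eqF y y')"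

end

theory Submission
  imports Defs "HOL-Library.Periodic_Fun"
begin

text \<open>
  Both assertions follow from a general principle. Let \<open>b\<close> be a bounded bilinear pairing of two seminormed
  spaces. Along norm-continuous periodic curves the integrand of the integrated pairing is
  continuous, so that pairing is again bilinear. Suppose \<open>w\<close> is a curve that annihilates all curves in the other
  space. For a fixed vector \<open>\<phi>\<close> the scalar function \<open>q t = b (w t) \<phi>\<close> is continuous and periodic, and the
  curve \<open>t \<mapsto> cnj (q t) \<phi>\<close> is a legitimate test curve; it shows that the integral of \<open>|q|\<^sup>2\<close> over a period is
  zero, hence \<open>q = 0\<close>. So each \<open>w t\<close> is annihilated by every \<open>\<phi>\<close>, and nondegeneracy of the integrated
  pairing follows from nondegeneracy of \<open>b\<close>. This is the content of the locale \<open>bounded_pairing\<close> and its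
  lemma \<open>nondegenerate_pairing_T\<close>.

  It remains to treat the two pairings at a single time. For \<open>L\<^sup>\<infinity>\<close> against \<open>L\<^sup>1\<close> boundedness is
  Hoelder's inequality; an element \<open>(a, \<psi>)\<close> is tested against its conjugate, and an element \<open>(c, g)\<close> against
  the conjugate phase of \<open>g\<close> (\<open>Xsunstar_separated\<close>, \<open>Xsun_separated\<close>).

  For bounded variation against continuous functions the Riemann--Stieltjes integral must first be
  shown to exist. Two Stieltjes sums are compared on their common refinement, where increments of \<open>f\<close> are
  dominated by increments of its variation function, which telescope (\<open>stieltjes_sum_cauchy_estimate\<close>).
  Continuous functions are separated by unit jumps, whose Stieltjes integral is a point evaluation
  (\<open>Xstar_pairing_jump\<close>). Functions of bounded variation are separated by ramps that approximate
  indicators of \<open>[0, s]\<close>: by summation by parts the integral is an average of values of \<open>f\<close> just to the right of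
  \<open>s\<close>, so right continuity recovers \<open>f s\<close> (\<open>Xstar_separated\<close>).
\<close>

section \<open>Seminormed spaces and periodic curves in them\<close>

lemma scaleC_zero_left [simp]: "(0::complex) *\<^sub>C x = (0::'a::complex_module)"
  using scaleC_add_left[of 0 0 x] by simp

lemma scaleC_minus_one: "(-1) *\<^sub>C x = - (x::'a::complex_module)"
  using scaleC_add_left[of 1 "-1" x] by (simp add: scaleC_one eq_neg_iff_add_eq_0 add.commute)

lemma scaleC_zero_right [simp]: "a *\<^sub>C (0::'a::complex_module) = 0"
  using scaleC_add_right[of a 0 "0::'a"] by simp

lemma scaleC_minus_right: "a *\<^sub>C (- y) = - (a *\<^sub>C (y::'a::complex_module))"
  using scaleC_add_right[of a "-y" y] by (simp add: eq_neg_iff_add_eq_0)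

lemma scaleC_diff_right: "a *\<^sub>C (x - y) = a *\<^sub>C x - a *\<^sub>C (y::'a::complex_module)"
  using scaleC_add_right[of a x "-y"] by (simp add: scaleC_minus_right)

lemma scaleC_minus_left: "(- a) *\<^sub>C x = - (a *\<^sub>C (x::'a::complex_module))"
  using scaleC_add_left[of "-a" a x] by (simp add: eq_neg_iff_add_eq_0)

lemma scaleC_diff_left: "(a - b) *\<^sub>C x = a *\<^sub>C x - b *\<^sub>C (x::'a::complex_module)"
  using scaleC_add_left[of a "-b" x] by (simp add: scaleC_minus_left)

text \<open>
  The four spaces are carriers inside types with far more elements, so the seminorm laws are required
  on the carrier only. Homogeneity is stated as an inequality, which keeps its verification to one
  estimate; the cases \<open>a = 0\<close> and \<open>a = -1\<close> still give the seminorm of zero and closure under differences.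
\<close>

locale seminormed_space =
  fixes E :: "'e::complex_module set" and nrm :: "'e \<Rightarrow> real"
  assumes zero_mem: "0 \<in> E"
    and add_mem: "x \<in> E \<Longrightarrow> y \<in> E \<Longrightarrow> x + y \<in> E"
    and scaleC_mem: "x \<in> E \<Longrightarrow> a *\<^sub>C x \<in> E"
    and nonneg: "x \<in> E \<Longrightarrow> 0 \<le> nrm x"
    and triangle: "x \<in> E \<Longrightarrow> y \<in> E \<Longrightarrow> nrm (x + y) \<le> nrm x + nrm y"
    and scaleC_le: "x \<in> E \<Longrightarrow> nrm (a *\<^sub>C x) \<le> cmod a * nrm x"
begin

lemma diff_mem: "x \<in> E \<Longrightarrow> y \<in> E \<Longrightarrow> x - y \<in> E"
  using add_mem[of x "(-1) *\<^sub>C y"] scaleC_mem[of y "-1"] by (simp add: scaleC_minus_one)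

lemma nrm_zero [simp]: "nrm 0 = 0"
  using scaleC_le[of 0 0] nonneg[of 0] zero_mem by simp

lemma C_per_mem: "u \<in> C_per T E nrm \<Longrightarrow> u t \<in> E"
  by (simp add: C_per_def)

lemma C_per_add:
  assumes u: "u \<in> C_per T E nrm" and v: "v \<in> C_per T E nrm"
  shows "u + v \<in> C_per T E nrm"
proof -
  have mem: "u t \<in> E" "v t \<in> E" for t using u v by (auto simp: C_per_def)
  have split: "(u + v) s - (u + v) t = (u s - u t) + (v s - v t)" for s t by simp
  have le: "nrm ((u + v) s - (u + v) t) \<le> nrm (u s - u t) + nrm (v s - v t)" for s t
    unfolding split by (intro triangle diff_mem mem)
  have ge: "0 \<le> nrm ((u + v) s - (u + v) t)" for s t
    by (intro nonneg diff_mem) (auto intro: add_mem mem)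
  have "nrm ((u + v) (t + T) - (u + v) t) = 0" for t
    using le[of "t + T" t] ge[of "t + T" t] u v by (simp add: C_per_def same_elem_def)
  moreover have "((\<lambda>s. nrm ((u + v) s - (u + v) t)) \<longlongrightarrow> 0) (at t)" for t
  proof (rule tendsto_sandwich[OF always_eventually always_eventually tendsto_const])
    show "((\<lambda>s. nrm (u s - u t) + nrm (v s - v t)) \<longlongrightarrow> 0) (at t)"
      using tendsto_add[of "\<lambda>s. nrm (u s - u t)" 0 "at t" "\<lambda>s. nrm (v s - v t)" 0] u v
      by (simp add: C_per_def)
  qed (intro allI ge le)+
  ultimately show ?thesis using mem by (auto simp: C_per_def same_elem_def intro: add_mem)
qed

lemma C_per_scaleC:
  assumes u: "u \<in> C_per T E nrm"
  shows "a *\<^sub>C u \<in> C_per T E nrm"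
proof -
  have mem: "u t \<in> E" for t using u by (auto simp: C_per_def)
  have app: "(a *\<^sub>C u) s = a *\<^sub>C u s" for s by (simp add: scaleC_fun_def)
  have le: "nrm ((a *\<^sub>C u) s - (a *\<^sub>C u) t) \<le> cmod a * nrm (u s - u t)" for s t
    unfolding app scaleC_diff_right[symmetric] by (intro scaleC_le diff_mem mem)
  have ge: "0 \<le> nrm ((a *\<^sub>C u) s - (a *\<^sub>C u) t)" for s t
    unfolding app by (intro nonneg diff_mem scaleC_mem mem)
  have "nrm ((a *\<^sub>C u) (t + T) - (a *\<^sub>C u) t) = 0" for t
    using le[of "t + T" t] ge[of "t + T" t] u by (simp add: C_per_def same_elem_def)
  moreover have "((\<lambda>s. nrm ((a *\<^sub>C u) s - (a *\<^sub>C u) t)) \<longlongrightarrow> 0) (at t)" for t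
  proof (rule tendsto_sandwich[OF always_eventually always_eventually tendsto_const])
    show "((\<lambda>s. cmod a * nrm (u s - u t)) \<longlongrightarrow> 0) (at t)"
      using u by (auto simp: C_per_def intro: tendsto_mult_right_zero)
  qed (intro allI ge le)+
  ultimately show ?thesis using mem by (auto simp: C_per_def same_elem_def app intro: scaleC_mem)
qed

lemma C_per_diff:
  assumes u: "u \<in> C_per T E nrm" and v: "v \<in> C_per T E nrm"
  shows "u - v \<in> C_per T E nrm"
  using C_per_add[OF u C_per_scaleC[OF v, of "-1"]] by (simp add: scaleC_minus_one)

text \<open>
  The test curves: a fixed vector multiplied by a continuous periodic scalar. They are all that is
  needed to pass from a statement about curves to one about single vectors.
\<close>

lemma modulated_in_C_per:
  assumes \<phi>: "\<phi> \<in> E" and per: "\<And>t. p (t + T) = p t" and cont: "continuous_on UNIV p"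
  shows "(\<lambda>t. p t *\<^sub>C \<phi>) \<in> C_per T E nrm"
proof -
  have le: "nrm (p s *\<^sub>C \<phi> - p t *\<^sub>C \<phi>) \<le> cmod (p s - p t) * nrm \<phi>" for s t
    unfolding scaleC_diff_left[symmetric] by (rule scaleC_le[OF \<phi>])
  have ge: "0 \<le> nrm (p s *\<^sub>C \<phi> - p t *\<^sub>C \<phi>)" for s t
    by (intro nonneg diff_mem scaleC_mem \<phi>)
  have "((\<lambda>s. nrm (p s *\<^sub>C \<phi> - p t *\<^sub>C \<phi>)) \<longlongrightarrow> 0) (at t)" for t
  proof (rule tendsto_sandwich[OF always_eventually always_eventually tendsto_const])
    have "(p \<longlongrightarrow> p t) (at t)"
      using cont by (simp add: continuous_on_def)
    then have "((\<lambda>s. cmod (p s - p t)) \<longlongrightarrow> 0) (at t)"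
      by (simp add: LIM_zero tendsto_norm_zero)
    then show "((\<lambda>s. cmod (p s - p t) * nrm \<phi>) \<longlongrightarrow> 0) (at t)"
      by (rule tendsto_mult_left_zero)
  qed (intro allI ge le)+
  then show ?thesis by (auto simp: C_per_def same_elem_def per scaleC_mem \<phi>)
qed

end

section \<open>Bounded pairings and their integrals over a period\<close>

locale bounded_pairing = E: seminormed_space E nE + F: seminormed_space F nF
  for E :: "'e::complex_module set" and nE and F :: "'f::complex_module set" and nF +
  fixes b :: "'e \<Rightarrow> 'f \<Rightarrow> complex"
  assumes bilinear: "bilinear_form_on E F b"
    and bound: "x \<in> E \<Longrightarrow> y \<in> F \<Longrightarrow> cmod (b x y) \<le> nE x * nF y"
begin

lemma add_left: "x \<in> E \<Longrightarrow> x' \<in> E \<Longrightarrow> y \<in> F \<Longrightarrow> b (x + x') y = b x y + b x' y"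
  and add_right: "x \<in> E \<Longrightarrow> y \<in> F \<Longrightarrow> y' \<in> F \<Longrightarrow> b x (y + y') = b x y + b x y'"
  and scale_left: "x \<in> E \<Longrightarrow> y \<in> F \<Longrightarrow> b (a *\<^sub>C x) y = a * b x y"
  and scale_right: "x \<in> E \<Longrightarrow> y \<in> F \<Longrightarrow> b x (a *\<^sub>C y) = a * b x y"
  using bilinear by (auto simp: bilinear_form_on_def)

lemma diff_left:
  assumes "x \<in> E" "x' \<in> E" "y \<in> F" shows "b (x - x') y = b x y - b x' y"
  using add_left[of x "(-1) *\<^sub>C x'" y] scale_left[of x' y "-1"] assms E.scaleC_mem[of x' "-1"]
  by (simp add: scaleC_minus_one)

text \<open>
  The locale is symmetric in its two spaces, so every one-sided result is proved for the left
  argument and transferred by this lemma.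
\<close>

lemma flipped: "bounded_pairing F nF E nE (\<lambda>y x. b x y)"
proof
  show "bilinear_form_on F E (\<lambda>y x. b x y)"
    using bilinear by (auto simp: bilinear_form_on_def)
qed (use bound in \<open>simp add: mult.commute\<close>)

lemma diff_right:
  assumes "x \<in> E" "y \<in> F" "y' \<in> F" shows "b x (y - y') = b x y - b x y'"
  using bounded_pairing.diff_left[OF flipped] assms by simp

text \<open>
  The curves are continuous in norm and the pairing is bounded, so the integrand is a continuous
  scalar function. This makes the integral over a period linear in each argument.
\<close>

lemma continuous_on_pairing:
  assumes u: "u \<in> C_per T E nE" and v: "v \<in> C_per T F nF"
  shows "continuous_on S (\<lambda>\<tau>. b (u \<tau>) (v \<tau>))"
proof -
  have mem: "u t \<in> E" "v t \<in> F" for t using u v by (auto simp: C_per_def)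
  have "((\<lambda>s. b (u s) (v s)) \<longlongrightarrow> b (u t) (v t)) (at t)" for t
  proof -
    let ?p = "\<lambda>s. nE (u s - u t)" and ?q = "\<lambda>s. nF (v s - v t)"
    have p0: "(?p \<longlongrightarrow> 0) (at t)" and q0: "(?q \<longlongrightarrow> 0) (at t)"
      using u v by (auto simp: C_per_def)
    have le: "norm (b (u s) (v s) - b (u t) (v t))
        \<le> ?p s * (nF (v t) + ?q s) + nE (u t) * ?q s" for s
    proof -
      \<comment> \<open>The norm of \<open>v s\<close> is in turn bounded by that of \<open>v t\<close> plus a term that tends to zero.\<close>
      have "b (u s) (v s) - b (u t) (v t) = b (u s - u t) (v s) + b (u t) (v s - v t)"
        by (simp add: diff_left diff_right mem)
      also have "norm \<dots> \<le> ?p s * nF (v s) + nE (u t) * ?q s"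
        by (intro norm_triangle_mono bound E.diff_mem F.diff_mem mem)
      also have "nF (v s) \<le> nF (v t) + ?q s"
        using F.triangle[of "v t" "v s - v t"] by (simp add: mem F.diff_mem)
      then have "?p s * nF (v s) \<le> ?p s * (nF (v t) + ?q s)"
        by (intro mult_left_mono E.nonneg E.diff_mem mem)
      finally show ?thesis by simp
    qed
    have "((\<lambda>s. ?p s * (nF (v t) + ?q s) + nE (u t) * ?q s) \<longlongrightarrow> 0 * (nF (v t) + 0) + nE (u t) * 0) (at t)"
      by (intro tendsto_intros p0 q0)
    then have "((\<lambda>s. ?p s * (nF (v t) + ?q s) + nE (u t) * ?q s) \<longlongrightarrow> 0) (at t)"
      by simp
    from Lim_null_comparison[OF always_eventually[OF allI[OF le]] this]
    have "((\<lambda>s. b (u s) (v s) - b (u t) (v t)) \<longlongrightarrow> 0) (at t)" .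
    then show ?thesis by (simp add: LIM_zero_iff)
  qed
  then have "continuous_on UNIV (\<lambda>\<tau>. b (u \<tau>) (v \<tau>))" by (simp add: continuous_on_def)
  then show ?thesis by (rule continuous_on_subset) simp
qed

lemma bilinear_pairing_T: "bilinear_form_on (C_per T E nE) (C_per T F nF) (pairing_T T b)"
proof -
  have int: "(\<lambda>\<tau>. b (u \<tau>) (v \<tau>)) integrable_on {0..T}"
    if "u \<in> C_per T E nE" "v \<in> C_per T F nF" for u v
    using continuous_on_pairing[OF that] by (rule integrable_continuous_real)
  show ?thesis
    unfolding bilinear_form_on_def pairing_T_def
    by (auto simp: add_left add_right scale_left scale_right E.C_per_mem F.C_per_mem
        scaleC_fun_def integral_add int)
qed

text \<open>
  For a fixed \<open>\<phi>\<close> the function \<open>q t = b (w t) \<phi>\<close> is itself continuous and periodic, so its conjugate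
  is an admissible modulation of \<open>\<phi>\<close>. Testing against that curve integrates \<open>|q|\<^sup>2\<close>, hence \<open>q\<close> vanishes on
  one period and therefore everywhere. As \<open>\<phi>\<close> is arbitrary, every \<open>w t\<close> is annihilated by the whole of \<open>F\<close>.
\<close>

lemma pairing_T_left_injective:
  assumes T: "0 < T"
    and nondeg: "\<And>x. x \<in> E \<Longrightarrow> (\<And>y. y \<in> F \<Longrightarrow> b x y = 0) \<Longrightarrow> nE x = 0"
    and w: "w \<in> C_per T E nE"
    and ann: "\<And>v. v \<in> C_per T F nF \<Longrightarrow> pairing_T T b w v = 0"
  shows "nE (w t) = 0"
proof (rule nondeg)
  show "w t \<in> E" by (rule E.C_per_mem[OF w])
  fix \<phi> assume \<phi>: "\<phi> \<in> F"
  define q where "q t = b (w t) \<phi>" for t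
  have const: "(\<lambda>_. \<phi>) \<in> C_per T F nF"
    using \<phi> by (simp add: C_per_def same_elem_def)
  have cont: "continuous_on S q" for S
    using continuous_on_pairing[OF w const] by (simp add: q_def[abs_def])
  have per: "q (t + T) = q t" for t
  proof -
    have "cmod (q (t + T) - q t) \<le> nE (w (t + T) - w t) * nF \<phi>"
      using bound[of "w (t + T) - w t" \<phi>]
      by (simp add: q_def diff_left E.C_per_mem[OF w] E.diff_mem \<phi>)
    then show ?thesis using w by (simp add: C_per_def same_elem_def)
  qed
  have "(\<lambda>t. cnj (q t) *\<^sub>C \<phi>) \<in> C_per T F nF"
    by (rule F.modulated_in_C_per[OF \<phi>]) (simp_all add: per continuous_on_cnj cont)
  from ann[OF this] have "integral {0..T} (\<lambda>t. cnj (q t) * q t) = 0"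
    by (simp add: pairing_T_def scale_right E.C_per_mem[OF w] \<phi> q_def)
  also have "(\<lambda>t. cnj (q t) * q t) = (\<lambda>t. complex_of_real ((cmod (q t))\<^sup>2))"
    by (simp add: complex_norm_square mult.commute del: of_real_power)
  finally have "integral {0..T} (complex_of_real \<circ> (\<lambda>t. (cmod (q t))\<^sup>2)) = 0"
    by (simp only: o_def)
  moreover have cont_sq: "continuous_on {0..T} (\<lambda>t. (cmod (q t))\<^sup>2)"
    by (intro continuous_intros cont)
  note integrable_continuous_real[OF this]
  ultimately have int0: "integral {0..T} (\<lambda>t. (cmod (q t))\<^sup>2) = 0"
    by (simp add: integral_linear[OF _ bounded_linear_of_real])
  have "\<forall>s\<in>{0..T}. (cmod (q s))\<^sup>2 = 0"
    using integral_eq_0_iff[OF cont_sq T] int0 by simp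
  then have zero: "q s = 0" if "s \<in> {0..T}" for s
    using that by simp
  \<comment> \<open>Every time is moved into \<open>[0, T]\<close> by an integer number of periods.\<close>
  interpret periodic_fun_simple q T by standard (rule per)
  define k where "k = \<lfloor>t / T\<rfloor>"
  have "of_int k \<le> t / T" "t / T < of_int k + 1" unfolding k_def by linarith+
  then have "t - of_int k * T \<in> {0..T}"
    using T by (auto simp: field_simps)
  then show "b (w t) \<phi> = 0"
    using zero minus_of_int[of t k] by (simp add: q_def)
qed

lemma pairing_T_cong_left:
  assumes u: "u \<in> C_per T E nE" "u' \<in> C_per T E nE" and eq: "same_fun nE u u'"
    and v: "v \<in> C_per T F nF"
  shows "pairing_T T b u v = pairing_T T b u' v"
proof -
  have "b (u t) (v t) = b (u' t) (v t)" for t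
  proof -
    have "cmod (b (u t - u' t) (v t)) \<le> nE (u t - u' t) * nF (v t)"
      by (intro bound E.diff_mem E.C_per_mem[OF u(1)] E.C_per_mem[OF u(2)] F.C_per_mem[OF v])
    then show ?thesis using eq
      by (simp add: same_fun_def same_elem_def diff_left E.C_per_mem[OF u(1)]
          E.C_per_mem[OF u(2)] F.C_per_mem[OF v])
  qed
  then show ?thesis by (simp add: pairing_T_def)
qed

lemma pairing_T_separates_left:
  assumes T: "0 < T"
    and nondeg: "\<And>x. x \<in> E \<Longrightarrow> (\<And>y. y \<in> F \<Longrightarrow> b x y = 0) \<Longrightarrow> nE x = 0"
    and u: "u \<in> C_per T E nE" "u' \<in> C_per T E nE"
  shows "(\<forall>v\<in>C_per T F nF. pairing_T T b u v = pairing_T T b u' v) \<longleftrightarrow> same_fun nE u u'"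
proof
  assume *: "\<forall>v\<in>C_per T F nF. pairing_T T b u v = pairing_T T b u' v"
  have "pairing_T T b (u - u') v = 0" if v: "v \<in> C_per T F nF" for v
  proof -
    have "pairing_T T b (u + (-1) *\<^sub>C u') v = pairing_T T b u v + (-1) * pairing_T T b u' v"
      using bilinear_pairing_T[of T] u E.C_per_scaleC[OF u(2), of "-1"] v
      unfolding bilinear_form_on_def by metis
    then show ?thesis using * v by (simp add: scaleC_minus_one)
  qed
  from pairing_T_left_injective[OF T nondeg E.C_per_diff[OF u] this]
  show "same_fun nE u u'" by (simp add: same_fun_def same_elem_def)
qed (use pairing_T_cong_left u in blast)

lemma nondegenerate_pairing_T:
  assumes T: "0 < T"
    and left: "\<And>x. x \<in> E \<Longrightarrow> (\<And>y. y \<in> F \<Longrightarrow> b x y = 0) \<Longrightarrow> nE x = 0"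
    and right: "\<And>y. y \<in> F \<Longrightarrow> (\<And>x. x \<in> E \<Longrightarrow> b x y = 0) \<Longrightarrow> nF y = 0"
  shows "nondegenerate_on (C_per T E nE) (same_fun nE) (C_per T F nF) (same_fun nF) (pairing_T T b)"
proof -
  have flip: "pairing_T T (\<lambda>y x. b x y) v u = pairing_T T b u v" for u v
    by (simp add: pairing_T_def)
  show ?thesis
    using pairing_T_separates_left[OF T left]
      bounded_pairing.pairing_T_separates_left[OF flipped T right]
    unfolding nondegenerate_on_def flip by blast
qed

end

section \<open>The product of a row with a column\<close>

lemma row_mult_add_left: "row_mult (c + c') a = row_mult c a + row_mult c' a"
  and row_mult_add_right: "row_mult c (a + a') = row_mult c a + row_mult c a'"
  and row_mult_diff_left: "row_mult (c - c') a = row_mult c a - row_mult c' a"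
  and row_mult_diff_right: "row_mult c (a - a') = row_mult c a - row_mult c a'"
  and row_mult_scaleC_left: "row_mult (z *\<^sub>C c) a = z * row_mult c a"
  and row_mult_scaleC_right: "row_mult c (z *\<^sub>C a) = z * row_mult c a"
  by (simp_all add: row_mult_def scaleC_vec_def scaleC_complex_def sum.distrib sum_subtractf
      sum_distrib_left algebra_simps)

lemma row_mult_commute: "row_mult c a = row_mult a c"
  by (simp add: row_mult_def mult.commute)

lemma row_mult_zero [simp]: "row_mult 0 a = 0" "row_mult c 0 = 0"
  by (simp_all add: row_mult_def)

lemma row_mult_axis [simp]: "row_mult (axis i 1) a = a $ i" "row_mult c (axis i 1) = c $ i"
  by (simp_all add: row_mult_def axis_def if_distrib if_distribR cong: if_cong)

lemma row_mult_scaleR: "row_mult (r *\<^sub>R c) a = of_real r * row_mult c a"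
  "row_mult c (r *\<^sub>R a) = of_real r * row_mult c a"
  unfolding row_mult_def vector_scaleR_component
  by (simp_all add: sum_distrib_left scaleR_conv_of_real algebra_simps)

lemma norm_row_mult_le: "norm (row_mult c a) \<le> norm c * norm a"
proof -
  have "norm (row_mult c a) \<le> (\<Sum>i\<in>UNIV. norm (c $ i) * norm (a $ i))"
    unfolding row_mult_def by (rule order_trans[OF norm_sum]) (simp add: norm_mult)
  also have "\<dots> \<le> norm c * norm a"
    unfolding norm_vec_def using L2_set_mult_ineq[of "\<lambda>i. norm (c $ i)" "\<lambda>i. norm (a $ i)" UNIV]
    by simp
  finally show ?thesis .
qed

lemma bounded_bilinear_row_mult: "bounded_bilinear (row_mult :: complex ^ 'n \<Rightarrow> _)"
proof
  show "\<exists>K. \<forall>c a :: complex ^ 'n. norm (row_mult c a) \<le> norm c * norm a * K"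
    by (rule exI[of _ 1]) (simp add: norm_row_mult_le)
qed (simp_all add: row_mult_add_left row_mult_add_right row_mult_scaleR scaleR_conv_of_real[where 'a = complex])

lemma norm_scaleC_vec: "norm (z *\<^sub>C (a :: complex ^ 'n)) = cmod z * norm a"
  by (simp add: norm_vec_def scaleC_vec_def scaleC_complex_def norm_mult L2_set_right_distrib)

text \<open>
  The product of a row with a column is bilinear, so conjugation has to be supplied by the test
  vector in order to produce a squared norm.
\<close>

definition cnj_vec :: "complex ^ 'n \<Rightarrow> complex ^ 'n" where
  "cnj_vec a = (\<chi> i. cnj (a $ i))"

lemma row_mult_cnj_vec: "row_mult (cnj_vec a) a = of_real ((norm a)\<^sup>2)"
proof -
  have "(norm a)\<^sup>2 = (\<Sum>i\<in>UNIV. (cmod (a $ i))\<^sup>2)"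
    by (simp add: norm_vec_def L2_set_def sum_nonneg)
  then have "of_real ((norm a)\<^sup>2) = (\<Sum>i\<in>UNIV. a $ i * cnj (a $ i))"
    by (simp only: of_real_sum complex_norm_square)
  then show ?thesis
    by (simp only: row_mult_def cnj_vec_def vec_lambda_beta mult.commute)
qed

lemma row_mult_cnj_vec': "row_mult a (cnj_vec a) = of_real ((norm a)\<^sup>2)"
  using row_mult_cnj_vec[of a] by (simp only: row_mult_commute)

lemma norm_cnj_vec [simp]: "norm (cnj_vec a) = norm a"
  by (simp add: norm_vec_def cnj_vec_def)

lemma bounded_linear_cnj_vec: "bounded_linear (cnj_vec :: complex ^ 'n \<Rightarrow> _)"
proof
  show "\<exists>K. \<forall>a :: complex ^ 'n. norm (cnj_vec a) \<le> norm a * K"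
    by (rule exI[of _ 1]) simp
qed (simp_all add: cnj_vec_def vec_eq_iff)

lemma borel_measurable_cnj_vec [measurable]:
  fixes f :: "'a \<Rightarrow> complex ^ 'n"
  assumes "f \<in> borel_measurable M" shows "(\<lambda>x. cnj_vec (f x)) \<in> borel_measurable M"
  by (intro measurable_compose[OF assms] borel_measurable_continuous_onI linear_continuous_on
      bounded_linear_cnj_vec)

lemma borel_measurable_row_mult [measurable]:
  fixes f g :: "'a \<Rightarrow> complex ^ 'n"
  assumes "f \<in> borel_measurable M" "g \<in> borel_measurable M"
  shows "(\<lambda>x. row_mult (f x) (g x)) \<in> borel_measurable M"
proof (rule borel_measurable_continuous_Pair[OF assms])
  show "continuous_on UNIV (\<lambda>x. row_mult (fst x) (snd x :: complex ^ 'n))"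
    by (intro bounded_bilinear.continuous_on[OF bounded_bilinear_row_mult] continuous_intros)
qed

lemma continuous_on_scaleC_vec:
  fixes f :: "'a::topological_space \<Rightarrow> complex ^ 'n"
  assumes "continuous_on S f" shows "continuous_on S (\<lambda>x. z *\<^sub>C f x)"
  unfolding scaleC_vec_def scaleC_complex_def using assms
  by (auto intro!: continuous_intros)

section \<open>The pairing of bounded with integrable functions\<close>

abbreviation delay_measure :: "real \<Rightarrow> real measure" where
  "delay_measure h \<equiv> lebesgue_on {-h..0}"

text \<open>
  The function \<open>g\<close> lives on \<open>[0, h]\<close> and \<open>\<psi>\<close> on \<open>[-h, 0]\<close>. Reflecting \<open>g\<close> rather than \<open>\<psi>\<close> transports all integrals
  to the measure space in which the essential supremum of \<open>\<psi>\<close> is taken, so that null sets never have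
  to be reflected.
\<close>

lemma Xsun_space_iff:
  "(c, g) \<in> Xsun_space h \<longleftrightarrow> integrable (delay_measure h) (\<lambda>s. g (- s))"
proof -
  have "(c, g) \<in> Xsun_space h \<longleftrightarrow> integrable (lebesgue_on {0..h}) g"
    unfolding Xsun_space_def set_integrable_def
    using integrable_restrict_space[of "{0..h}" lebesgue g] by simp
  also have "\<dots> \<longleftrightarrow> integrable (delay_measure h) (\<lambda>s. g (- s))"
    using Equivalence_Lebesgue_Henstock_Integration.integrable_reflect_real[of h 0 g] by simp
  finally show ?thesis .
qed

lemma integral_reflect_delay:
  fixes f :: "real \<Rightarrow> 'a::euclidean_space"
  assumes "integrable (delay_measure h) (\<lambda>s. f (- s))"
  shows "integral {0..h} f = (LINT s|delay_measure h. f (- s))"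
  using lebesgue_integral_eq_integral[OF assms]
    Henstock_Kurzweil_Integration.integral_reflect_real[of h 0 f] by simp

lemma Xsun_norm_eq:
  assumes "(c, g) \<in> Xsun_space h"
  shows "Xsun_norm h (c, g) = norm c + (LINT s|delay_measure h. norm (g (- s)))"
  using assms integral_reflect_delay[of h "\<lambda>s. norm (g s)"]
  by (simp add: Xsun_space_iff Xsun_norm_def)

lemma seminormed_space_Xsun: "seminormed_space (Xsun_space h) (Xsun_norm h)"
proof
  show "0 \<in> Xsun_space h"
    by (simp add: zero_prod_def Xsun_space_iff)
next
  fix x y :: "(complex ^ 'n) \<times> (real \<Rightarrow> complex ^ 'n)"
  assume xy: "x \<in> Xsun_space h" "y \<in> Xsun_space h"
  obtain c g c' g' where [simp]: "x = (c, g)" "y = (c', g')" by (cases x, cases y)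
  have int: "integrable (delay_measure h) (\<lambda>s. g (- s))" "integrable (delay_measure h) (\<lambda>s. g' (- s))"
    using xy by (auto simp: Xsun_space_iff)
  show mem: "x + y \<in> Xsun_space h"
    using int by (simp add: Xsun_space_iff)
  have "(LINT s|delay_measure h. norm ((g + g') (- s)))
      \<le> (LINT s|delay_measure h. norm (g (- s)) + norm (g' (- s)))"
    using int by (intro integral_mono) (auto intro: norm_triangle_ineq)
  then show "Xsun_norm h (x + y) \<le> Xsun_norm h x + Xsun_norm h y"
    using Xsun_norm_eq[of "c + c'" "g + g'" h] Xsun_norm_eq[of c g h] Xsun_norm_eq[of c' g' h] xy mem int
      norm_triangle_ineq[of c c'] by simp
next
  fix x :: "(complex ^ 'n) \<times> (real \<Rightarrow> complex ^ 'n)" and a :: complex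
  assume x: "x \<in> Xsun_space h"
  obtain c g where [simp]: "x = (c, g)" by (cases x)
  have ax: "a *\<^sub>C (c, g) = (a *\<^sub>C c, \<lambda>s. a *\<^sub>C g s)" by (simp add: scaleC_prod_def scaleC_fun_def)
  have int: "integrable (delay_measure h) (\<lambda>s. g (- s))"
    using x by (auto simp: Xsun_space_iff)
  have "bounded_linear (\<lambda>v :: complex ^ 'n. a *\<^sub>C v)"
  proof
    show "\<exists>K. \<forall>v :: complex ^ 'n. norm (a *\<^sub>C v) \<le> norm v * K"
      by (rule exI[of _ "cmod a"]) (simp add: norm_scaleC_vec mult.commute)
  qed (simp_all add: scaleC_vec_def vec_eq_iff scaleC_complex_def distrib_left)
  from integrable_bounded_linear[OF this int]
  show mem: "a *\<^sub>C x \<in> Xsun_space h" by (simp add: ax Xsun_space_iff)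
  show "0 \<le> Xsun_norm h x" using Xsun_norm_eq[of c g h] x by simp
  show "Xsun_norm h (a *\<^sub>C x) \<le> cmod a * Xsun_norm h x"
    using Xsun_norm_eq[of c g h] Xsun_norm_eq[of "a *\<^sub>C c" "\<lambda>s. a *\<^sub>C g s" h] x mem
    by (simp add: ax norm_scaleC_vec algebra_simps)
qed

text \<open>
  This uses that the interval has positive length: over a null space an essential supremum is
  \<open>-\<infinity>\<close>, and \<open>real_of_ereal\<close> would map it to zero.
\<close>

lemma essnorm_nonneg:
  fixes \<psi> :: "real \<Rightarrow> complex ^ 'n"
  assumes "0 < h" shows "0 \<le> essnorm h \<psi>"
proof (cases "(\<lambda>\<theta>. ereal (norm (\<psi> \<theta>))) \<in> borel_measurable (delay_measure h)")
  case True
  have "emeasure (delay_measure h) (space (delay_measure h)) \<noteq> 0"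
    using assms by (simp add: emeasure_restrict_space)
  then have "esssup (delay_measure h) (\<lambda>_. 0 :: ereal) = 0" by (rule esssup_const)
  moreover have "esssup (delay_measure h) (\<lambda>_. 0 :: ereal) \<le> essnorm h \<psi>"
    unfolding essnorm_def by (rule esssup_mono) simp_all
  ultimately show ?thesis by simp
qed (simp add: essnorm_def esssup_non_measurable)

lemma essnorm_finite:
  assumes "0 < h" "(a, \<psi>) \<in> Xsunstar_space h"
  shows "ereal (real_of_ereal (essnorm h \<psi>)) = essnorm h \<psi>"
  using essnorm_nonneg[OF assms(1), of \<psi>] assms(2)
  by (intro ereal_real') (auto simp: Xsunstar_space_def)

lemma AE_norm_le_essnorm:
  assumes "0 < h" "(a, \<psi>) \<in> Xsunstar_space h"
  shows "AE s in delay_measure h. norm (\<psi> s) \<le> real_of_ereal (essnorm h \<psi>)"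
proof -
  have "AE s in delay_measure h. ereal (norm (\<psi> s)) \<le> essnorm h \<psi>"
    unfolding essnorm_def by (rule esssup_AE)
  then show ?thesis
    by (subst (asm) essnorm_finite[OF assms, symmetric]) simp
qed

lemma essnorm_leI:
  assumes "\<psi> \<in> borel_measurable (delay_measure h)" "AE s in delay_measure h. norm (\<psi> s) \<le> M"
  shows "essnorm h \<psi> \<le> ereal M"
  unfolding essnorm_def using assms by (intro esssup_I) auto

lemma seminormed_space_Xsunstar:
  assumes h: "0 < h"
  shows "seminormed_space (Xsunstar_space h :: ((complex ^ 'n) \<times> _) set) (Xsunstar_norm h)"
proof
  have "essnorm h (0 :: real \<Rightarrow> complex ^ 'n) \<le> ereal 0"
    by (rule essnorm_leI) (auto simp: zero_fun_def)
  then show "0 \<in> (Xsunstar_space h :: ((complex ^ 'n) \<times> _) set)"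
    by (auto simp: Xsunstar_space_def zero_prod_def zero_fun_def)
next
  fix x y :: "(complex ^ 'n) \<times> (real \<Rightarrow> complex ^ 'n)"
  assume xy: "x \<in> Xsunstar_space h" "y \<in> Xsunstar_space h"
  obtain a \<psi> a' \<psi>' where [simp]: "x = (a, \<psi>)" "y = (a', \<psi>')" by (cases x, cases y)
  let ?M = "real_of_ereal (essnorm h \<psi>)" and ?M' = "real_of_ereal (essnorm h \<psi>')"
  have [measurable]: "\<psi> \<in> borel_measurable (delay_measure h)" "\<psi>' \<in> borel_measurable (delay_measure h)"
    using xy by (auto simp: Xsunstar_space_def)
  have m: "\<psi> + \<psi>' \<in> borel_measurable (delay_measure h)"
    unfolding plus_fun_def by measurable
  have "AE s in delay_measure h. norm ((\<psi> + \<psi>') s) \<le> ?M + ?M'"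
    using AE_norm_le_essnorm[OF h, of a \<psi>] AE_norm_le_essnorm[OF h, of a' \<psi>'] xy
    by (auto elim!: eventually_elim2 intro: norm_triangle_mono)
  from essnorm_leI[OF m this] have le: "essnorm h (\<psi> + \<psi>') \<le> ereal (?M + ?M')" .
  then show mem: "x + y \<in> Xsunstar_space h"
    using m by (auto simp: Xsunstar_space_def)
  have "real_of_ereal (essnorm h (\<psi> + \<psi>')) \<le> ?M + ?M'"
    using le essnorm_finite[OF h, of "a + a'" "\<psi> + \<psi>'"] mem
    by (metis \<open>x = (a, \<psi>)\<close> \<open>y = (a', \<psi>')\<close> add_Pair ereal_less_eq(3))
  then show "Xsunstar_norm h (x + y) \<le> Xsunstar_norm h x + Xsunstar_norm h y"
    using norm_triangle_ineq[of a a'] by (auto simp: Xsunstar_norm_def)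
next
  fix x :: "(complex ^ 'n) \<times> (real \<Rightarrow> complex ^ 'n)" and z :: complex
  assume x: "x \<in> Xsunstar_space h"
  obtain a \<psi> where [simp]: "x = (a, \<psi>)" by (cases x)
  have zx: "z *\<^sub>C (a, \<psi>) = (z *\<^sub>C a, \<lambda>s. z *\<^sub>C \<psi> s)" by (simp add: scaleC_prod_def scaleC_fun_def)
  let ?M = "real_of_ereal (essnorm h \<psi>)"
  have [measurable]: "\<psi> \<in> borel_measurable (delay_measure h)"
    using x by (auto simp: Xsunstar_space_def)
  have m: "(\<lambda>s. z *\<^sub>C \<psi> s) \<in> borel_measurable (delay_measure h)"
    by (rule measurable_compose[of \<psi> _ borel]) (auto intro!: borel_measurable_continuous_onI
        continuous_on_scaleC_vec)
  have "AE s in delay_measure h. norm (z *\<^sub>C \<psi> s) \<le> cmod z * ?M"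
    using AE_norm_le_essnorm[OF h, of a \<psi>] x
    by (auto simp: norm_scaleC_vec elim!: eventually_mono intro: mult_left_mono)
  from essnorm_leI[OF m this] have le: "essnorm h (\<lambda>s. z *\<^sub>C \<psi> s) \<le> ereal (cmod z * ?M)" .
  then show mem: "z *\<^sub>C x \<in> Xsunstar_space h"
    using m by (auto simp: Xsunstar_space_def zx)
  show "0 \<le> Xsunstar_norm h x"
    by (simp add: Xsunstar_norm_def le_max_iff_disj)
  have "real_of_ereal (essnorm h (\<lambda>s. z *\<^sub>C \<psi> s)) \<le> cmod z * ?M"
    using le essnorm_finite[OF h, of "z *\<^sub>C a" "\<lambda>s. z *\<^sub>C \<psi> s"] mem
    by (metis zx \<open>x = (a, \<psi>)\<close> ereal_less_eq(3))
  also have "\<dots> \<le> cmod z * max (norm a) ?M" by (intro mult_left_mono) auto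
  finally show "Xsunstar_norm h (z *\<^sub>C x) \<le> cmod z * Xsunstar_norm h x"
    by (simp add: zx Xsunstar_norm_def norm_scaleC_vec mult_left_mono)
qed

text \<open>
  Hoelder's inequality for the exponents one and infinity, in its qualitative form.
\<close>

lemma integrable_row_mult_sun:
  assumes h: "0 < h" and x: "(a, \<psi>) \<in> Xsunstar_space h" and y: "(c, g) \<in> Xsun_space h"
  shows "integrable (delay_measure h) (\<lambda>s. row_mult (g (- s)) (\<psi> s))"
proof (rule Bochner_Integration.integrable_bound)
  let ?M = "real_of_ereal (essnorm h \<psi>)"
  have [measurable]: "\<psi> \<in> borel_measurable (delay_measure h)"
    using x by (auto simp: Xsunstar_space_def)
  have int: "integrable (delay_measure h) (\<lambda>s. g (- s))" using y by (simp add: Xsun_space_iff)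
  then have [measurable]: "(\<lambda>s. g (- s)) \<in> borel_measurable (delay_measure h)" by simp
  show "integrable (delay_measure h) (\<lambda>s. norm (g (- s)) * ?M)" using int by simp
  show "(\<lambda>s. row_mult (g (- s)) (\<psi> s)) \<in> borel_measurable (delay_measure h)" by measurable
  show "AE s in delay_measure h. norm (row_mult (g (- s)) (\<psi> s)) \<le> norm (norm (g (- s)) * ?M)"
    using AE_norm_le_essnorm[OF h x]
  proof (rule eventually_mono)
    fix s assume "norm (\<psi> s) \<le> ?M"
    then show "norm (row_mult (g (- s)) (\<psi> s)) \<le> norm (norm (g (- s)) * ?M)"
      using order_trans[OF norm_row_mult_le mult_left_mono[of "norm (\<psi> s)" ?M "norm (g (- s))"]]
        order_trans[OF _ abs_ge_self] by (metis norm_ge_zero real_norm_def)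
  qed
qed

lemma Xsunstar_pairing_eq:
  assumes "0 < h" "(a, \<psi>) \<in> Xsunstar_space h" "(c, g) \<in> Xsun_space h"
  shows "Xsunstar_pairing h (a, \<psi>) (c, g)
    = row_mult c a + (LINT s|delay_measure h. row_mult (g (- s)) (\<psi> s))"
  unfolding Xsunstar_pairing_def
  using integral_reflect_delay[of h "\<lambda>\<theta>. row_mult (g \<theta>) (\<psi> (- \<theta>))"] integrable_row_mult_sun[OF assms]
  by simp

lemma bounded_pairing_Xsunstar:
  assumes h: "0 < h"
  shows "bounded_pairing (Xsunstar_space h :: ((complex ^ 'n) \<times> _) set) (Xsunstar_norm h)
    (Xsun_space h) (Xsun_norm h) (Xsunstar_pairing h)"
proof -
  interpret S: seminormed_space "Xsunstar_space h :: ((complex ^ 'n) \<times> _) set" "Xsunstar_norm h"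
    by (rule seminormed_space_Xsunstar[OF h])
  interpret L: seminormed_space "Xsun_space h :: ((complex ^ 'n) \<times> _) set" "Xsun_norm h"
    by (rule seminormed_space_Xsun)
  have add_left: "Xsunstar_pairing h (x + x') y = Xsunstar_pairing h x y + Xsunstar_pairing h x' y"
    if xy: "x \<in> Xsunstar_space h" "x' \<in> Xsunstar_space h" "y \<in> Xsun_space h"
    for x x' y :: "(complex ^ 'n) \<times> (real \<Rightarrow> complex ^ 'n)"
  proof -
    obtain a \<psi> a' \<psi>' c g where [simp]: "x = (a, \<psi>)" "x' = (a', \<psi>')" "y = (c, g)"
      by (cases x, cases x', cases y)
    show ?thesis
      using xy S.add_mem[OF xy(1,2)] integrable_row_mult_sun[OF h, of a \<psi> c g]
        integrable_row_mult_sun[OF h, of a' \<psi>' c g]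
      by (simp add: Xsunstar_pairing_eq[OF h] row_mult_add_right)
  qed
  have add_right: "Xsunstar_pairing h x (y + y') = Xsunstar_pairing h x y + Xsunstar_pairing h x y'"
    if xy: "x \<in> Xsunstar_space h" "y \<in> Xsun_space h" "y' \<in> Xsun_space h"
    for x y y' :: "(complex ^ 'n) \<times> (real \<Rightarrow> complex ^ 'n)"
  proof -
    obtain a \<psi> c' g' c g where [simp]: "x = (a, \<psi>)" "y' = (c', g')" "y = (c, g)"
      by (cases x, cases y', cases y)
    show ?thesis
      using xy L.add_mem[OF xy(2,3)] integrable_row_mult_sun[OF h, of a \<psi> c g]
        integrable_row_mult_sun[OF h, of a \<psi> c' g']
      by (simp add: Xsunstar_pairing_eq[OF h] row_mult_add_left)
  qed
  have scale: "Xsunstar_pairing h (z *\<^sub>C x) y = z * Xsunstar_pairing h x y"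
    "Xsunstar_pairing h x (z *\<^sub>C y) = z * Xsunstar_pairing h x y"
    if xy: "x \<in> Xsunstar_space h" "y \<in> Xsun_space h"
    for x y :: "(complex ^ 'n) \<times> (real \<Rightarrow> complex ^ 'n)" and z
  proof -
    obtain a \<psi> c g where [simp]: "x = (a, \<psi>)" "y = (c, g)"
      by (cases x, cases y)
    have z: "z *\<^sub>C x = (z *\<^sub>C a, \<lambda>s. z *\<^sub>C \<psi> s)" "z *\<^sub>C y = (z *\<^sub>C c, \<lambda>s. z *\<^sub>C g s)"
      by (simp_all add: scaleC_prod_def scaleC_fun_def)
    show "Xsunstar_pairing h (z *\<^sub>C x) y = z * Xsunstar_pairing h x y"
      using xy S.scaleC_mem[OF xy(1), of z] unfolding z
      by (simp add: Xsunstar_pairing_eq[OF h] row_mult_scaleC_right distrib_left)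
    show "Xsunstar_pairing h x (z *\<^sub>C y) = z * Xsunstar_pairing h x y"
      using xy L.scaleC_mem[OF xy(2), of z] unfolding z
      by (simp add: Xsunstar_pairing_eq[OF h] row_mult_scaleC_left distrib_left)
  qed
  show ?thesis
  proof
    show "bilinear_form_on (Xsunstar_space h :: ((complex ^ 'n) \<times> _) set) (Xsun_space h) (Xsunstar_pairing h)"
      unfolding bilinear_form_on_def using add_left add_right scale by auto
  next
    fix x y :: "(complex ^ 'n) \<times> (real \<Rightarrow> complex ^ 'n)"
    assume xy: "x \<in> Xsunstar_space h" "y \<in> Xsun_space h"
    obtain a \<psi> c g where [simp]: "x = (a, \<psi>)" "y = (c, g)"
      by (cases x, cases y)
    let ?M = "real_of_ereal (essnorm h \<psi>)"
    have x: "(a, \<psi>) \<in> Xsunstar_space h" and y: "(c, g) \<in> Xsun_space h" using xy by auto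
    have int: "integrable (delay_measure h) (\<lambda>s. g (- s))" using y by (simp add: Xsun_space_iff)
    have "norm (LINT s|delay_measure h. row_mult (g (- s)) (\<psi> s))
        \<le> (LINT s|delay_measure h. norm (row_mult (g (- s)) (\<psi> s)))"
      by (rule integral_norm_bound)
    also have "\<dots> \<le> (LINT s|delay_measure h. norm (g (- s)) * ?M)"
    proof (rule integral_mono_AE)
      show "AE s in delay_measure h. norm (row_mult (g (- s)) (\<psi> s)) \<le> norm (g (- s)) * ?M"
        using AE_norm_le_essnorm[OF h x]
        by (rule eventually_mono) (intro order_trans[OF norm_row_mult_le] mult_left_mono norm_ge_zero)
    qed (use int integrable_row_mult_sun[OF h x y] in auto)
    finally have "cmod (Xsunstar_pairing h x y)
        \<le> norm c * norm a + (LINT s|delay_measure h. norm (g (- s))) * ?M"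
      using norm_triangle_ineq[of "row_mult c a" "LINT s|delay_measure h. row_mult (g (- s)) (\<psi> s)"]
        norm_row_mult_le[of c a]
      by (simp add: Xsunstar_pairing_eq[OF h x y])
    also have "\<dots> \<le> norm c * max (norm a) ?M + (LINT s|delay_measure h. norm (g (- s))) * max (norm a) ?M"
      by (intro add_mono mult_left_mono) (auto intro: integral_nonneg_AE)
    also have "\<dots> = Xsunstar_norm h x * Xsun_norm h y"
      by (simp add: Xsunstar_norm_def Xsun_norm_eq[OF y] algebra_simps)
    finally show "cmod (Xsunstar_pairing h x y) \<le> Xsunstar_norm h x * Xsun_norm h y" .
  qed
qed

text \<open>
  A bounded measurable function on a finite interval is integrable, so the conjugate of \<open>(a, \<psi>)\<close> is
  itself an admissible test element; pairing with it gives \<open>|a|\<^sup>2\<close> plus the integral of \<open>|\<psi>|\<^sup>2\<close>.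
\<close>

lemma Xsunstar_separated:
  fixes x :: "(complex ^ 'n) \<times> (real \<Rightarrow> complex ^ 'n)"
  assumes h: "0 < h" and x: "x \<in> Xsunstar_space h"
    and ann: "\<And>y. y \<in> Xsun_space h \<Longrightarrow> Xsunstar_pairing h x y = 0"
  shows "Xsunstar_norm h x = 0"
proof -
  obtain a \<psi> where x_eq [simp]: "x = (a, \<psi>)" by (cases x)
  let ?M = "real_of_ereal (essnorm h \<psi>)"
  have ax: "(a, \<psi>) \<in> Xsunstar_space h" using x by simp
  then have [measurable]: "\<psi> \<in> borel_measurable (delay_measure h)"
    by (auto simp: Xsunstar_space_def)
  have fin: "finite_measure (delay_measure h)"
    by (rule finite_measureI) (simp add: emeasure_restrict_space emeasure_lborel_Icc_eq)
  have mem: "(cnj_vec a, \<lambda>\<theta>. cnj_vec (\<psi> (- \<theta>))) \<in> Xsun_space h"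
    unfolding Xsun_space_iff
  proof (rule finite_measure.integrable_const_bound[OF fin])
    show "AE s in delay_measure h. norm (cnj_vec (\<psi> (- (- s)))) \<le> ?M"
      using AE_norm_le_essnorm[OF h ax] by simp
  qed simp
  have "Xsunstar_pairing h x (cnj_vec a, \<lambda>\<theta>. cnj_vec (\<psi> (- \<theta>)))
      = of_real ((norm a)\<^sup>2 + (LINT s|delay_measure h. (norm (\<psi> s))\<^sup>2))"
    by (simp add: Xsunstar_pairing_eq[OF h ax mem] row_mult_cnj_vec del: of_real_power)
  then have sum0: "(norm a)\<^sup>2 + (LINT s|delay_measure h. (norm (\<psi> s))\<^sup>2) = 0"
    using ann[OF mem] by (metis of_real_eq_0_iff)
  have nn: "0 \<le> (LINT s|delay_measure h. (norm (\<psi> s))\<^sup>2)" by (rule integral_nonneg_AE) simp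
  have "a = 0" "(LINT s|delay_measure h. (norm (\<psi> s))\<^sup>2) = 0"
    using sum0 nn by (simp_all add: add_nonneg_eq_0_iff)
  moreover have "integrable (delay_measure h) (\<lambda>s. (norm (\<psi> s))\<^sup>2)"
  proof -
    have "integrable (delay_measure h) (\<lambda>s. complex_of_real ((norm (\<psi> s))\<^sup>2))"
      using integrable_row_mult_sun[OF h ax mem] by (simp add: row_mult_cnj_vec del: of_real_power)
    then show ?thesis by (simp only: complex_of_real_integrable_eq)
  qed
  ultimately have "AE s in delay_measure h. (norm (\<psi> s))\<^sup>2 = 0"
    by (subst (asm) integral_nonneg_eq_0_iff_AE) auto
  then have "AE s in delay_measure h. norm (\<psi> s) \<le> 0" by simp
  then have "essnorm h \<psi> \<le> ereal 0" by (intro essnorm_leI) auto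
  then have "essnorm h \<psi> = 0" using essnorm_nonneg[OF h, of \<psi>] by (simp add: zero_ereal_def antisym)
  then show ?thesis using \<open>a = 0\<close> by (simp add: Xsunstar_norm_def)
qed

text \<open>
  An integrable \<open>g\<close> need not be bounded, so its conjugate is first normalised pointwise. The pairing with
  that phase function is the \<open>L\<^sup>1\<close> norm of \<open>g\<close>.
\<close>

lemma Xsun_separated:
  fixes y :: "(complex ^ 'n) \<times> (real \<Rightarrow> complex ^ 'n)"
  assumes h: "0 < h" and y: "y \<in> Xsun_space h"
    and ann: "\<And>x. x \<in> Xsunstar_space h \<Longrightarrow> Xsunstar_pairing h x y = 0"
  shows "Xsun_norm h y = 0"
proof -
  obtain c g where y_eq [simp]: "y = (c, g)" by (cases y)
  have cy: "(c, g) \<in> Xsun_space h" using y by simp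
  then have int: "integrable (delay_measure h) (\<lambda>s. g (- s))" by (simp add: Xsun_space_iff)
  then have [measurable]: "(\<lambda>s. g (- s)) \<in> borel_measurable (delay_measure h)" by simp
  \<comment> \<open>As \<open>inverse 0 = 0\<close>, the phase function vanishes where \<open>g\<close> does.\<close>
  define \<psi> where "\<psi> s = cnj_vec (inverse (norm (g (- s))) *\<^sub>R g (- s))" for s
  have m: "\<psi> \<in> borel_measurable (delay_measure h)"
    unfolding \<psi>_def[abs_def] by measurable
  have "essnorm h \<psi> \<le> ereal 1"
    by (rule essnorm_leI[OF m]) (simp add: \<psi>_def field_simps)
  then have mem: "(cnj_vec c, \<psi>) \<in> Xsunstar_space h"
    using m by (auto simp: Xsunstar_space_def)
  have "row_mult (g (- s)) (\<psi> s) = of_real (norm (g (- s)))" for s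
  proof -
    have "\<psi> s = inverse (norm (g (- s))) *\<^sub>R cnj_vec (g (- s))"
      by (simp add: \<psi>_def cnj_vec_def vec_eq_iff)
    then show ?thesis
      by (cases "g (- s) = 0") (simp_all add: row_mult_scaleR row_mult_cnj_vec' power2_eq_square field_simps)
  qed
  then have "Xsunstar_pairing h (cnj_vec c, \<psi>) y
      = of_real ((norm c)\<^sup>2 + (LINT s|delay_measure h. norm (g (- s))))"
    by (simp add: Xsunstar_pairing_eq[OF h mem cy] row_mult_cnj_vec' del: of_real_power)
  then have sum0: "(norm c)\<^sup>2 + (LINT s|delay_measure h. norm (g (- s))) = 0"
    using ann[OF mem] by (metis of_real_eq_0_iff)
  have "0 \<le> (LINT s|delay_measure h. norm (g (- s)))" by (rule integral_nonneg_AE) simp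
  with sum0 show ?thesis
    using Xsun_norm_eq[OF cy] by (simp add: add_nonneg_eq_0_iff)
qed

section \<open>Functions of bounded variation and continuous functions\<close>

lemma division_sum_le_Xstar_norm:
  assumes "f \<in> Xstar_space h" "d division_of {0..h}"
  shows "(\<Sum>K\<in>d. norm (f (Sup K) - f (Inf K))) \<le> Xstar_norm h f"
  unfolding Xstar_norm_def using assms
  by (intro cSup_upper) (auto simp: variation_sums_def Xstar_space_def)

lemma division_of_self_real: "a \<le> b \<Longrightarrow> {{a..b}} division_of {a..b::real}"
  using division_of_self[of a b] by simp

lemma variation_sums_nonempty: "a \<le> b \<Longrightarrow> variation_sums a b f \<noteq> {}"
  using division_of_self_real[of a b] by (auto simp: variation_sums_def)

lemma variation_sums_nonneg: "s \<in> variation_sums a b f \<Longrightarrow> 0 \<le> s"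
  by (auto simp: variation_sums_def intro: sum_nonneg)

lemma Xstar_norm_leI:
  assumes "0 \<le> h" "\<And>d. d division_of {0..h} \<Longrightarrow> (\<Sum>K\<in>d. norm (f (Sup K) - f (Inf K))) \<le> B"
  shows "Xstar_norm h f \<le> B"
  unfolding Xstar_norm_def using assms
  by (intro cSup_least variation_sums_nonempty) (auto simp: variation_sums_def)

lemma Xstar_norm_nonneg:
  assumes "0 \<le> h" "f \<in> Xstar_space h" shows "0 \<le> Xstar_norm h f"
  by (rule order_trans[OF _ division_sum_le_Xstar_norm[OF assms(2) division_of_self_real[OF assms(1)]]])
    (simp add: sum_nonneg)

lemma seminormed_space_Xstar:
  assumes h: "0 < h"
  shows "seminormed_space (Xstar_space h :: (real \<Rightarrow> complex ^ 'n) set) (Xstar_norm h)"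
proof
  show "(0 :: real \<Rightarrow> complex ^ 'n) \<in> Xstar_space h"
    by (auto simp: Xstar_space_def variation_sums_def zero_fun_def bdd_above_def)
next
  fix f g :: "real \<Rightarrow> complex ^ 'n"
  assume fg: "f \<in> Xstar_space h" "g \<in> Xstar_space h"
  have le: "(\<Sum>K\<in>d. norm ((f + g) (Sup K) - (f + g) (Inf K))) \<le> Xstar_norm h f + Xstar_norm h g"
    if "d division_of {0..h}" for d
  proof -
    have "norm ((f + g) (Sup K) - (f + g) (Inf K))
        \<le> norm (f (Sup K) - f (Inf K)) + norm (g (Sup K) - g (Inf K))" for K
      using norm_triangle_ineq[of "f (Sup K) - f (Inf K)" "g (Sup K) - g (Inf K)"]
      by (simp add: algebra_simps)
    then have "(\<Sum>K\<in>d. norm ((f + g) (Sup K) - (f + g) (Inf K)))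
        \<le> (\<Sum>K\<in>d. norm (f (Sup K) - f (Inf K))) + (\<Sum>K\<in>d. norm (g (Sup K) - g (Inf K)))"
      unfolding sum.distrib[symmetric] by (rule sum_mono)
    also have "\<dots> \<le> Xstar_norm h f + Xstar_norm h g"
      by (intro add_mono division_sum_le_Xstar_norm fg that)
    finally show ?thesis .
  qed
  then have "bdd_above (variation_sums 0 h (f + g))"
    unfolding bdd_above_def variation_sums_def by blast
  then show "f + g \<in> Xstar_space h"
    using fg by (auto simp: Xstar_space_def plus_fun_def intro: continuous_add)
  show "Xstar_norm h (f + g) \<le> Xstar_norm h f + Xstar_norm h g"
    using h by (intro Xstar_norm_leI le) auto
next
  fix f :: "real \<Rightarrow> complex ^ 'n" and z :: complex
  assume f: "f \<in> Xstar_space h"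
  have le: "(\<Sum>K\<in>d. norm ((z *\<^sub>C f) (Sup K) - (z *\<^sub>C f) (Inf K))) \<le> cmod z * Xstar_norm h f"
    if "d division_of {0..h}" for d
    using mult_left_mono[OF division_sum_le_Xstar_norm[OF f that] norm_ge_zero[of z]]
    by (simp add: scaleC_fun_def scaleC_diff_right[symmetric] norm_scaleC_vec sum_distrib_left)
  then have "bdd_above (variation_sums 0 h (z *\<^sub>C f))"
    unfolding bdd_above_def variation_sums_def by blast
  moreover have "continuous (at_right \<theta>) (z *\<^sub>C f)" if "continuous (at_right \<theta>) f" for \<theta>
    using that unfolding scaleC_fun_def scaleC_vec_def scaleC_complex_def continuous_def
    by (intro tendsto_intros)
  ultimately show "z *\<^sub>C f \<in> Xstar_space h"
    using f by (auto simp: Xstar_space_def scaleC_fun_def)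
  show "Xstar_norm h (z *\<^sub>C f) \<le> cmod z * Xstar_norm h f"
    using h by (intro Xstar_norm_leI le) auto
  show "0 \<le> Xstar_norm h f" using h f by (intro Xstar_norm_nonneg) auto
qed

lemma norm_le_X_norm:
  assumes "\<phi> \<in> X_space h" "\<theta> \<in> {-h..0}" shows "norm (\<phi> \<theta>) \<le> X_norm h \<phi>"
  unfolding X_norm_def
proof (rule cSUP_upper[OF assms(2)])
  have "compact ((\<lambda>\<theta>. norm (\<phi> \<theta>)) ` {-h..0})"
    using assms(1) by (intro compact_continuous_image) (auto simp: X_space_def intro: continuous_on_norm)
  then show "bdd_above ((\<lambda>\<theta>. norm (\<phi> \<theta>)) ` {-h..0})"
    by (intro bounded_imp_bdd_above compact_imp_bounded)
qed

lemma X_norm_leI: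
  assumes "0 \<le> h" "\<And>\<theta>. \<theta> \<in> {-h..0} \<Longrightarrow> norm (\<phi> \<theta>) \<le> B" shows "X_norm h \<phi> \<le> B"
  unfolding X_norm_def using assms by (intro cSUP_least) auto

lemma seminormed_space_X:
  assumes h: "0 < h"
  shows "seminormed_space (X_space h :: (real \<Rightarrow> complex ^ 'n) set) (X_norm h)"
proof
  show "(0 :: real \<Rightarrow> complex ^ 'n) \<in> X_space h" by (simp add: X_space_def zero_fun_def)
next
  fix \<phi> \<psi> :: "real \<Rightarrow> complex ^ 'n"
  assume *: "\<phi> \<in> X_space h" "\<psi> \<in> X_space h"
  show "\<phi> + \<psi> \<in> X_space h"
    using * by (simp add: X_space_def plus_fun_def continuous_on_add)
  show "X_norm h (\<phi> + \<psi>) \<le> X_norm h \<phi> + X_norm h \<psi>"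
    using h by (intro X_norm_leI) (auto intro!: norm_triangle_mono norm_le_X_norm *)
next
  fix \<phi> :: "real \<Rightarrow> complex ^ 'n" and z :: complex
  assume *: "\<phi> \<in> X_space h"
  show "z *\<^sub>C \<phi> \<in> X_space h"
    using * by (simp add: X_space_def scaleC_fun_def continuous_on_scaleC_vec)
  show "X_norm h (z *\<^sub>C \<phi>) \<le> cmod z * X_norm h \<phi>"
    using h by (intro X_norm_leI) (auto simp: scaleC_fun_def norm_scaleC_vec intro!: mult_left_mono norm_le_X_norm *)
  show "0 \<le> X_norm h \<phi>"
    using norm_le_X_norm[OF *, of 0] h
    by (simp add: order_trans[OF norm_ge_zero])
qed

section \<open>Increments and the variation function\<close>

text \<open>
  Sums of increment norms over a partition are awkward to
  compare between partitions, whereas the increments of the scalar function \<open>v\<close> telescope. Bounds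
  on such sums therefore go through a dominating \<open>v\<close>: the variation function for a general \<open>f\<close>, and the
  jump function itself for a jump.
\<close>

definition increments_le :: "real \<Rightarrow> (real \<Rightarrow> 'a::real_normed_vector) \<Rightarrow> (real \<Rightarrow> real) \<Rightarrow> bool" where
  "increments_le h f v \<longleftrightarrow> (\<forall>a b. 0 \<le> a \<longrightarrow> a \<le> b \<longrightarrow> b \<le> h \<longrightarrow> norm (f b - f a) \<le> v b - v a)"

lemma increments_leD:
  "increments_le h f v \<Longrightarrow> 0 \<le> a \<Longrightarrow> a \<le> b \<Longrightarrow> b \<le> h \<Longrightarrow> norm (f b - f a) \<le> v b - v a"
  by (simp add: increments_le_def)

text \<open>
  Adding one more interval to a division adds one more increment; this superadditivity is why the variation
  function dominates increments.
\<close>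

lemma variation_sums_extend:
  assumes s: "s \<in> variation_sums 0 a f" and ab: "0 \<le> a" "a \<le> b"
  shows "s + norm (f b - f a) \<in> variation_sums 0 b f"
proof (cases "a = b")
  case False
  with ab have "a < b" by simp
  obtain d where d: "d division_of {0..a}" and s_eq: "s = (\<Sum>K\<in>d. norm (f (Sup K) - f (Inf K)))"
    using s by (auto simp: variation_sums_def)
  have "d \<union> {{a..b}} division_of {0..a} \<union> {a..b}"
    using ab by (intro division_disjoint_union d division_of_self_real) auto
  moreover have "{0..a} \<union> {a..b} = {0..b}" using ab by auto
  ultimately have "insert {a..b} d division_of {0..b}" by simp
  moreover have "{a..b} \<notin> d"
  proof
    assume "{a..b} \<in> d"
    then have "{a..b} \<subseteq> {0..a}" using d by blast
    then show False using \<open>a < b\<close> by auto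
  qed
  then have "(\<Sum>K\<in>insert {a..b} d. norm (f (Sup K) - f (Inf K))) = s + norm (f b - f a)"
    using division_of_finite[OF d] ab by (simp add: s_eq)
  ultimately show ?thesis unfolding variation_sums_def by force
qed (use s in simp)

definition variation :: "(real \<Rightarrow> 'a::real_normed_vector) \<Rightarrow> real \<Rightarrow> real" where
  "variation f x = Sup (variation_sums 0 x f)"

lemma increments_le_variation:
  assumes "bdd_above (variation_sums 0 h f)"
  shows "increments_le h f (variation f)"
  unfolding increments_le_def
proof (intro allI impI)
  fix a b :: real assume ab: "0 \<le> a" "a \<le> b" "b \<le> h"
  obtain B where B: "\<And>s. s \<in> variation_sums 0 h f \<Longrightarrow> s \<le> B"
    using assms by (auto simp: bdd_above_def)
  have "s \<le> B" if "s \<in> variation_sums 0 b f" for s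
    using B[OF variation_sums_extend[OF that]] ab norm_ge_zero[of "f h - f b"] by linarith
  then have bdd: "bdd_above (variation_sums 0 b f)" by (auto simp: bdd_above_def)
  have "variation f a \<le> variation f b - norm (f b - f a)"
    unfolding variation_def
  proof (rule cSup_least[OF variation_sums_nonempty[OF ab(1)]])
    fix s assume "s \<in> variation_sums 0 a f"
    from cSup_upper[OF variation_sums_extend[OF this ab(1,2)] bdd]
    show "s \<le> Sup (variation_sums 0 b f) - norm (f b - f a)" by simp
  qed
  then show "norm (f b - f a) \<le> variation f b - variation f a" by simp
qed

lemma increments_le_Xstar:
  assumes "f \<in> Xstar_space h" shows "increments_le h f (variation f)"
  using assms by (intro increments_le_variation) (simp add: Xstar_space_def)

lemma total_variation_le_Xstar_norm:
  assumes h: "0 \<le> h" and f: "f \<in> Xstar_space h"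
  shows "variation f h - variation f 0 \<le> Xstar_norm h f"
proof -
  have "variation_sums 0 0 f \<noteq> {}" by (simp add: variation_sums_nonempty)
  then obtain s where s: "s \<in> variation_sums 0 0 f" by blast
  have "bdd_above (variation_sums 0 0 f)"
  proof (rule bdd_aboveI)
    fix s assume s: "s \<in> variation_sums 0 0 f"
    have "s + norm (f h - f 0) \<le> Xstar_norm h f"
      unfolding Xstar_norm_def
      using f by (intro cSup_upper variation_sums_extend s h) (simp_all add: Xstar_space_def)
    then show "s \<le> Xstar_norm h f" using norm_ge_zero[of "f h - f 0"] by linarith
  qed
  then have "0 \<le> variation f 0"
    unfolding variation_def
    by (rule order_trans[OF variation_sums_nonneg[OF s] cSup_upper[OF s]])
  then show ?thesis by (simp add: variation_def Xstar_norm_def)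
qed

lemma tagged_division_member:
  assumes "p tagged_division_of {a..b::real}" "(x, K) \<in> p"
  shows "K = {Inf K..Sup K}" "a \<le> Inf K" "Inf K \<le> x" "x \<le> Sup K" "Sup K \<le> b" "Inf K \<le> Sup K"
proof -
  obtain u w where K: "K = {u..w}" using tagged_division_ofD(4)[OF assms] by auto
  have "x \<in> K" "K \<subseteq> {a..b}" using tagged_division_ofD(2,3)[OF assms] by auto
  then show "K = {Inf K..Sup K}" "a \<le> Inf K" "Inf K \<le> x" "x \<le> Sup K" "Sup K \<le> b" "Inf K \<le> Sup K"
    using K by auto
qed

lemma sum_increments_le:
  assumes h: "0 \<le> h" and v: "increments_le h f v" and p: "p tagged_division_of {0..h}"
  shows "(\<Sum>(x, K)\<in>p. norm (f (Sup K) - f (Inf K))) \<le> v h - v 0"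
proof -
  have "(\<Sum>(x, K)\<in>p. norm (f (Sup K) - f (Inf K))) \<le> (\<Sum>(x, K)\<in>p. v (Sup K) - v (Inf K))"
  proof (rule sum_mono, clarify)
    fix x K assume "(x, K) \<in> p"
    from tagged_division_member[OF p this] show "norm (f (Sup K) - f (Inf K)) \<le> v (Sup K) - v (Inf K)"
      by (intro increments_leD[OF v]) auto
  qed
  also have "\<dots> = v h - v 0" by (rule additive_tagged_division_1[OF h p])
  finally show ?thesis .
qed

lemma division_sum_increments_le:
  assumes h: "0 \<le> h" and v: "increments_le h f v" and d: "d division_of {0..h}"
  shows "(\<Sum>K\<in>d. norm (f (Sup K) - f (Inf K))) \<le> v h - v 0"
proof -
  have Inf_mem: "Inf K \<in> K" if "K \<in> d" for K
    using division_ofD(3,4)[OF d that] by auto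
  have "(\<lambda>K. (Inf K, K)) ` d tagged_division_of {0..h}"
  proof (rule tagged_division_ofI)
    show "\<Union>{K. \<exists>x. (x, K) \<in> (\<lambda>K. (Inf K, K)) ` d} = {0..h}"
      using division_ofD(6)[OF d] by (auto simp: image_iff)
  next
    fix x1 K1 x2 K2
    assume "(x1, K1) \<in> (\<lambda>K. (Inf K, K)) ` d" "(x2, K2) \<in> (\<lambda>K. (Inf K, K)) ` d" "(x1, K1) \<noteq> (x2, K2)"
    then show "interior K1 \<inter> interior K2 = {}" by (intro division_ofD(5)[OF d]) auto
  qed (use division_ofD(1,2,4)[OF d] Inf_mem in auto)
  from sum_increments_le[OF h v this] show ?thesis
    by (simp add: sum.reindex inj_on_def)
qed

section \<open>Existence of the Stieltjes integral\<close>

definition stieltjes_sum ::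
  "(real \<Rightarrow> complex ^ 'n) \<Rightarrow> (real \<Rightarrow> complex ^ 'n) \<Rightarrow> (real \<times> real set) set \<Rightarrow> complex" where
  "stieltjes_sum f \<phi> p = (\<Sum>(x, K)\<in>p. row_mult (f (Sup K) - f (Inf K)) (\<phi> (- x)))"

text \<open>
  Convergence of Stieltjes sums as the mesh tends to zero is convergence along this filter, so
  linearity, bounds and uniqueness of the integral come from the general limit theorems.
\<close>

definition mesh_filter :: "real \<Rightarrow> (real \<times> real set) set filter" where
  "mesh_filter h = (INF d\<in>{0<..}. principal {p. p tagged_division_of {0..h} \<and> (\<lambda>x. ball x d) fine p})"

lemma eventually_mesh_filter:
  "eventually P (mesh_filter h) \<longleftrightarrow>
    (\<exists>d>0. \<forall>p. p tagged_division_of {0..h} \<and> (\<lambda>x. ball x d) fine p \<longrightarrow> P p)"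
proof -
  have "\<exists>d\<in>{0<..}. {p. p tagged_division_of {0..h} \<and> (\<lambda>x. ball x d) fine p}
      \<subseteq> {p. p tagged_division_of {0..h} \<and> (\<lambda>x. ball x d1) fine p} \<inter>
        {p. p tagged_division_of {0..h} \<and> (\<lambda>x. ball x d2) fine p}" if "d1 > 0" "d2 > 0" for d1 d2
    using that by (intro bexI[of _ "min d1 d2"]) (auto simp: fine_def subset_iff)
  then show ?thesis
    unfolding mesh_filter_def
    by (subst eventually_INF_base) (auto simp: eventually_principal)
qed

lemma mesh_filter_nontrivial [simp]: "mesh_filter h \<noteq> bot"
proof -
  have "\<exists>p. p tagged_division_of {0..h} \<and> (\<lambda>x. ball x d) fine p" if "d > 0" for d
    using fine_division_exists_real[OF gauge_ball[OF that], of 0 h] by metis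
  then show ?thesis
    unfolding trivial_limit_def eventually_mesh_filter by blast
qed

lemma eventually_tagged_division: "eventually (\<lambda>p. p tagged_division_of {0..h}) (mesh_filter h)"
  unfolding eventually_mesh_filter by (rule exI[of _ 1]) auto

lemma has_stieltjes_pairing_iff_tendsto:
  "has_stieltjes_pairing h f \<phi> I \<longleftrightarrow> (stieltjes_sum f \<phi> \<longlongrightarrow> I) (mesh_filter h)"
  by (simp add: has_stieltjes_pairing_def tendsto_iff eventually_mesh_filter stieltjes_sum_def
      dist_norm)

lemma Xstar_pairing_eqI:
  assumes "(stieltjes_sum f \<phi> \<longlongrightarrow> I) (mesh_filter h)" shows "Xstar_pairing h f \<phi> = I"
  unfolding Xstar_pairing_def has_stieltjes_pairing_iff_tendsto
  using assms tendsto_unique[OF mesh_filter_nontrivial] by blast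

text \<open>
  The increment of \<open>g\<close> over the intersection of two intervals, expressed by clamping the ends of \<open>L\<close> to \<open>K\<close>.
  In this form an empty intersection contributes zero without a case distinction, and for fixed \<open>K\<close> the
  sum over a partition into intervals \<open>L\<close> telescopes.
\<close>

definition overlap_increment ::
  "(real \<Rightarrow> 'a::ab_group_add) \<Rightarrow> real set \<Rightarrow> real set \<Rightarrow> 'a" where
  "overlap_increment g K L =
     g (max (Inf K) (min (Sup K) (Sup L))) - g (max (Inf K) (min (Sup K) (Inf L)))"

lemma sum_overlap_increment:
  fixes g :: "real \<Rightarrow> 'a::real_normed_vector"
  assumes h: "0 \<le> h" and q: "q tagged_division_of {0..h}"
    and K: "0 \<le> Inf K" "Inf K \<le> Sup K" "Sup K \<le> h"
  shows "(\<Sum>(y, L)\<in>q. overlap_increment g K L) = g (Sup K) - g (Inf K)"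
  unfolding overlap_increment_def
  using additive_tagged_division_1[OF h q, of "\<lambda>t. g (max (Inf K) (min (Sup K) t))"] K
  by (simp add: min_absorb1 min_absorb2 max_absorb1 max_absorb2)

lemma overlap_increment_commute:
  assumes "Inf K \<le> Sup K" "Inf L \<le> Sup L"
  shows "overlap_increment g K L = overlap_increment g L K"
  using assms by (auto simp: overlap_increment_def max_def min_def)

lemma overlap_increment_disjoint:
  assumes "Inf K \<le> Sup K" "Inf L \<le> Sup L" "Sup K < Inf L \<or> Sup L < Inf K"
  shows "overlap_increment g K L = 0"
  using assms by (auto simp: overlap_increment_def max_def min_def)

lemma row_mult_sum: "row_mult (sum F A) a = (\<Sum>i\<in>A. row_mult (F i) a)"
  by (induction A rule: infinite_finite_induct) (simp_all add: row_mult_add_left)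

lemma stieltjes_sum_refine:
  assumes h: "0 \<le> h" and p: "p tagged_division_of {0..h}" and q: "q tagged_division_of {0..h}"
  shows "stieltjes_sum f \<phi> p = (\<Sum>(x, K)\<in>p. \<Sum>(y, L)\<in>q. row_mult (overlap_increment f K L) (\<phi> (- x)))"
  unfolding stieltjes_sum_def
proof (rule sum.cong[OF refl], clarify)
  fix x K assume "(x, K) \<in> p"
  note K = tagged_division_member[OF p this]
  from sum_overlap_increment[OF h q K(2,6,5), of f]
  show "row_mult (f (Sup K) - f (Inf K)) (\<phi> (- x))
      = (\<Sum>(y, L)\<in>q. row_mult (overlap_increment f K L) (\<phi> (- x)))"
    by (simp add: row_mult_sum[symmetric] case_prod_unfold)
qed

text \<open>
  Both sums are written over the common refinement of the two partitions. Only pairs of intervals that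
  meet contribute, and their tags are less than \<open>2 * d\<close> apart, so the difference is bounded by the
  oscillation of \<open>\<phi>\<close> times the telescoping sum of the increments of \<open>v\<close>.
\<close>

lemma stieltjes_sum_cauchy_estimate:
  assumes h: "0 \<le> h" and v: "increments_le h f v"
    and p: "p tagged_division_of {0..h}" "(\<lambda>x. ball x d) fine p"
    and q: "q tagged_division_of {0..h}" "(\<lambda>x. ball x d) fine q"
    and osc: "\<And>x y. x \<in> {0..h} \<Longrightarrow> y \<in> {0..h} \<Longrightarrow> \<bar>x - y\<bar> < 2 * d \<Longrightarrow> norm (\<phi> (- x) - \<phi> (- y)) \<le> e"
  shows "norm (stieltjes_sum f \<phi> p - stieltjes_sum f \<phi> q) \<le> (v h - v 0) * e"
proof -
  have comm: "overlap_increment f L K = overlap_increment f K L"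
    if xK: "(x, K) \<in> p" and yL: "(y, L) \<in> q" for x K y L
    by (intro overlap_increment_commute tagged_division_member[OF p(1) xK]
        tagged_division_member[OF q(1) yL])
  have "stieltjes_sum f \<phi> q = (\<Sum>(y, L)\<in>q. \<Sum>(x, K)\<in>p. row_mult (overlap_increment f K L) (\<phi> (- y)))"
    unfolding stieltjes_sum_refine[OF h q(1) p(1)]
  proof (rule sum.cong[OF refl], clarify, rule sum.cong[OF refl], clarify)
    fix y L x K assume "(y, L) \<in> q" "(x, K) \<in> p"
    then show "row_mult (overlap_increment f L K) (\<phi> (- y)) = row_mult (overlap_increment f K L) (\<phi> (- y))"
      by (simp only: comm)
  qed
  also have "\<dots> = (\<Sum>(x, K)\<in>p. \<Sum>(y, L)\<in>q. row_mult (overlap_increment f K L) (\<phi> (- y)))"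
    unfolding case_prod_unfold by (rule sum.swap)
  finally have "stieltjes_sum f \<phi> p - stieltjes_sum f \<phi> q
      = (\<Sum>(x, K)\<in>p. \<Sum>(y, L)\<in>q. row_mult (overlap_increment f K L) (\<phi> (- x) - \<phi> (- y)))"
    unfolding stieltjes_sum_refine[OF h p(1) q(1)]
    by (simp add: row_mult_diff_right sum_subtractf case_prod_unfold)
  also have "norm \<dots> \<le> (\<Sum>(x, K)\<in>p. \<Sum>(y, L)\<in>q. overlap_increment v K L * e)"
  proof (intro sum_norm_le, clarify, intro sum_norm_le, clarify)
    fix x K y L assume xK: "(x, K) \<in> p" and yL: "(y, L) \<in> q"
    note K = tagged_division_member[OF p(1) xK] and L = tagged_division_member[OF q(1) yL]
    show "norm (row_mult (overlap_increment f K L) (\<phi> (- x) - \<phi> (- y))) \<le> overlap_increment v K L * e"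
    proof (cases "Sup K < Inf L \<or> Sup L < Inf K")
      case True
      then show ?thesis by (simp add: overlap_increment_disjoint[OF K(6) L(6)])
    next
      case False
      then have "max (Inf K) (Inf L) \<in> {Inf K..Sup K}" "max (Inf K) (Inf L) \<in> {Inf L..Sup L}"
        using K(6) L(6) by auto
      then obtain z where "z \<in> K" "z \<in> L" using K(1) L(1) by blast
      then have "\<bar>x - z\<bar> < d" "\<bar>y - z\<bar> < d"
        using fineD[OF p(2) xK] fineD[OF q(2) yL] by (auto simp: dist_real_def)
      then have "norm (\<phi> (- x) - \<phi> (- y)) \<le> e"
        using K(2-5) L(2-5) by (intro osc) auto
      moreover have "norm (overlap_increment f K L) \<le> overlap_increment v K L"
        unfolding overlap_increment_def using K(2-6) L(2-6) by (intro increments_leD[OF v]) (auto simp: max_def min_def)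
      ultimately show ?thesis
        by (intro order_trans[OF norm_row_mult_le] mult_mono)
          (auto intro: order_trans[OF norm_ge_zero])
    qed
  qed
  also have "\<dots> = (\<Sum>(x, K)\<in>p. (v (Sup K) - v (Inf K)) * e)"
  proof (rule sum.cong[OF refl], clarify)
    fix x K assume "(x, K) \<in> p"
    note K = tagged_division_member[OF p(1) this]
    from sum_overlap_increment[OF h q(1) K(2,6,5), of v]
    show "(\<Sum>(y, L)\<in>q. overlap_increment v K L * e) = (v (Sup K) - v (Inf K)) * e"
      by (simp add: case_prod_unfold sum_distrib_right[symmetric])
  qed
  also have "\<dots> = (v h - v 0) * e"
    using additive_tagged_division_1[OF h p(1), of v]
    by (simp add: case_prod_unfold sum_distrib_right[symmetric])
  finally show ?thesis .
qed

text \<open>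
  The estimate above and uniform continuity make the sums Cauchy with respect to the mesh. The limit is
  found along a sequence of partitions with mesh tending to zero and then serves for all fine ones.
\<close>

lemma stieltjes_sum_converges:
  assumes h: "0 \<le> h" and v: "increments_le h f v" and \<phi>: "\<phi> \<in> X_space h"
  shows "\<exists>I. (stieltjes_sum f \<phi> \<longlongrightarrow> I) (mesh_filter h)"
proof -
  let ?F = "\<lambda>d p. p tagged_division_of {0..h} \<and> (\<lambda>x. ball x d) fine p"
  have V: "0 \<le> v h - v 0"
    using increments_leD[OF v, of 0 h] h norm_ge_zero[of "f h - f 0"] by linarith
  have cauchy: "\<exists>d>0. \<forall>p q. ?F d p \<and> ?F d q \<longrightarrow> norm (stieltjes_sum f \<phi> p - stieltjes_sum f \<phi> q) < e"
    if e: "e > 0" for e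
  proof -
    \<comment> \<open>The summand 1 avoids division by zero when the total variation vanishes.\<close>
    let ?e = "e / (v h - v 0 + 1)"
    have e': "0 < ?e" using e V by simp
    have "uniformly_continuous_on {-h..0} \<phi>"
      using \<phi> by (intro compact_uniformly_continuous) (auto simp: X_space_def)
    then obtain d where d: "d > 0"
      and unif: "\<And>x y. x \<in> {-h..0} \<Longrightarrow> y \<in> {-h..0} \<Longrightarrow> dist x y < d \<Longrightarrow> dist (\<phi> x) (\<phi> y) < ?e"
      unfolding uniformly_continuous_on_def using e' by metis
    have "norm (stieltjes_sum f \<phi> p - stieltjes_sum f \<phi> q) < e"
      if p: "?F (d / 2) p" and q: "?F (d / 2) q" for p q
    proof -
      have "norm (stieltjes_sum f \<phi> p - stieltjes_sum f \<phi> q) \<le> (v h - v 0) * ?e"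
      proof (rule stieltjes_sum_cauchy_estimate[OF h v])
        fix x y assume "x \<in> {0..h}" "y \<in> {0..h}" "\<bar>x - y\<bar> < 2 * (d / 2)"
        then show "norm (\<phi> (- x) - \<phi> (- y)) \<le> ?e"
          using unif[of "- x" "- y"] by (simp add: dist_norm abs_minus_commute)
      qed (use p q in auto)
      also have "\<dots> < (v h - v 0 + 1) * ?e" by (intro mult_strict_right_mono e') simp
      also have "\<dots> = e" using V by simp
      finally show ?thesis .
    qed
    then show ?thesis using d by (intro exI[of _ "d / 2"]) auto
  qed
  have "\<exists>p. ?F (inverse (real (Suc n))) p" for n
    using fine_division_exists_real[OF gauge_ball, of "inverse (real (Suc n))" 0 h]
    by (metis inverse_positive_iff_positive of_nat_0_less_iff zero_less_Suc)
  then obtain P where P: "\<And>n. ?F (inverse (real (Suc n))) (P n)" by metis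
  have P_fine: "\<exists>N. \<forall>n\<ge>N. ?F d (P n)" if d: "d > 0" for d
  proof -
    obtain N where N: "inverse (real (Suc N)) < d" using reals_Archimedean[OF d] by blast
    have "?F d (P n)" if "n \<ge> N" for n
    proof -
      have "inverse (real (Suc n)) \<le> inverse (real (Suc N))"
        using that by (intro le_imp_inverse_le) auto
      then have "ball x (inverse (real (Suc n))) \<subseteq> ball x d" for x :: real
        using N by (intro subset_ball) linarith
      then show ?thesis using P[of n] unfolding fine_def by blast
    qed
    then show ?thesis by blast
  qed
  have "Cauchy (\<lambda>n. stieltjes_sum f \<phi> (P n))"
  proof (rule CauchyI)
    fix e :: real assume "e > 0"
    then obtain d where d: "d > 0"
      "\<And>p q. ?F d p \<Longrightarrow> ?F d q \<Longrightarrow> norm (stieltjes_sum f \<phi> p - stieltjes_sum f \<phi> q) < e"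
      using cauchy by meson
    then show "\<exists>M. \<forall>m\<ge>M. \<forall>n\<ge>M. norm (stieltjes_sum f \<phi> (P m) - stieltjes_sum f \<phi> (P n)) < e"
      using P_fine[OF d(1)] by blast
  qed
  then obtain I where I: "(\<lambda>n. stieltjes_sum f \<phi> (P n)) \<longlonglongrightarrow> I"
    using Cauchy_convergent convergent_def by blast
  have "(stieltjes_sum f \<phi> \<longlongrightarrow> I) (mesh_filter h)"
    unfolding tendsto_iff eventually_mesh_filter
  proof (intro allI impI)
    fix e :: real assume "e > 0"
    then have e2: "e / 2 > 0" by simp
    obtain d where d: "d > 0"
      "\<And>p q. ?F d p \<Longrightarrow> ?F d q \<Longrightarrow> norm (stieltjes_sum f \<phi> p - stieltjes_sum f \<phi> q) < e / 2"
      using cauchy[OF e2] by meson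
    obtain N where N: "\<And>n. n \<ge> N \<Longrightarrow> ?F d (P n)" using P_fine[OF d(1)] by blast
    obtain M where M: "\<And>n. n \<ge> M \<Longrightarrow> dist (stieltjes_sum f \<phi> (P n)) I < e / 2"
      using I e2 unfolding lim_sequentially by blast
    have "dist (stieltjes_sum f \<phi> p) I < e" if "?F d p" for p
      using d(2)[OF that N[of "max M N"]] M[of "max M N"]
        dist_triangle[of "stieltjes_sum f \<phi> p" I "stieltjes_sum f \<phi> (P (max M N))"]
      by (simp add: dist_norm)
    then show "\<exists>d>0. \<forall>p. ?F d p \<longrightarrow> dist (stieltjes_sum f \<phi> p) I < e" using d(1) by blast
  qed
  then show ?thesis by blast
qed

section \<open>The pairing of bounded variation with continuous functions\<close>

lemma tendsto_Xstar_pairing: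
  assumes h: "0 \<le> h" and f: "f \<in> Xstar_space h" and \<phi>: "\<phi> \<in> X_space h"
  shows "(stieltjes_sum f \<phi> \<longlongrightarrow> Xstar_pairing h f \<phi>) (mesh_filter h)"
  using stieltjes_sum_converges[OF h increments_le_Xstar[OF f] \<phi>] Xstar_pairing_eqI by blast

lemma bounded_pairing_Xstar:
  assumes h: "0 < h"
  shows "bounded_pairing (Xstar_space h :: (real \<Rightarrow> complex ^ 'n) set) (Xstar_norm h)
    (X_space h) (X_norm h) (Xstar_pairing h)"
proof -
  interpret S: seminormed_space "Xstar_space h :: (real \<Rightarrow> complex ^ 'n) set" "Xstar_norm h"
    by (rule seminormed_space_Xstar[OF h])
  interpret X: seminormed_space "X_space h :: (real \<Rightarrow> complex ^ 'n) set" "X_norm h"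
    by (rule seminormed_space_X[OF h])
  note lim = tendsto_Xstar_pairing[OF less_imp_le[OF h]]
  show ?thesis
  proof
    have "Xstar_pairing h (f + f') \<phi> = Xstar_pairing h f \<phi> + Xstar_pairing h f' \<phi>"
      if "f \<in> Xstar_space h" "f' \<in> Xstar_space h" "\<phi> \<in> X_space h" for f f' \<phi> :: "real \<Rightarrow> complex ^ 'n"
    proof -
      have "stieltjes_sum (f + f') \<phi> = (\<lambda>p. stieltjes_sum f \<phi> p + stieltjes_sum f' \<phi> p)"
        by (simp add: fun_eq_iff stieltjes_sum_def case_prod_unfold row_mult_diff_left
            row_mult_add_left sum.distrib sum_subtractf)
      then show ?thesis using tendsto_add[OF lim[OF that(1,3)] lim[OF that(2,3)]]
        by (intro Xstar_pairing_eqI) simp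
    qed
    moreover have "Xstar_pairing h f (\<phi> + \<phi>') = Xstar_pairing h f \<phi> + Xstar_pairing h f \<phi>'"
      if "f \<in> Xstar_space h" "\<phi> \<in> X_space h" "\<phi>' \<in> X_space h" for f \<phi> \<phi>' :: "real \<Rightarrow> complex ^ 'n"
    proof -
      have "stieltjes_sum f (\<phi> + \<phi>') = (\<lambda>p. stieltjes_sum f \<phi> p + stieltjes_sum f \<phi>' p)"
        by (simp add: fun_eq_iff stieltjes_sum_def case_prod_unfold row_mult_add_right sum.distrib)
      then show ?thesis using tendsto_add[OF lim[OF that(1,2)] lim[OF that(1,3)]]
        by (intro Xstar_pairing_eqI) simp
    qed
    moreover have "Xstar_pairing h (z *\<^sub>C f) \<phi> = z * Xstar_pairing h f \<phi>"
      "Xstar_pairing h f (z *\<^sub>C \<phi>) = z * Xstar_pairing h f \<phi>"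
      if "f \<in> Xstar_space h" "\<phi> \<in> X_space h" for f \<phi> :: "real \<Rightarrow> complex ^ 'n" and z
    proof -
      have "stieltjes_sum (z *\<^sub>C f) \<phi> = (\<lambda>p. z * stieltjes_sum f \<phi> p)"
        "stieltjes_sum f (z *\<^sub>C \<phi>) = (\<lambda>p. z * stieltjes_sum f \<phi> p)"
        by (simp_all add: fun_eq_iff stieltjes_sum_def case_prod_unfold scaleC_fun_def
            scaleC_diff_right[symmetric] row_mult_scaleC_left row_mult_scaleC_right sum_distrib_left)
      then show "Xstar_pairing h (z *\<^sub>C f) \<phi> = z * Xstar_pairing h f \<phi>"
        "Xstar_pairing h f (z *\<^sub>C \<phi>) = z * Xstar_pairing h f \<phi>"
        using tendsto_mult[OF tendsto_const lim[OF that]] by (auto intro!: Xstar_pairing_eqI)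
    qed
    ultimately show "bilinear_form_on (Xstar_space h :: (real \<Rightarrow> complex ^ 'n) set) (X_space h) (Xstar_pairing h)"
      unfolding bilinear_form_on_def by auto
  next
    fix f \<phi> :: "real \<Rightarrow> complex ^ 'n"
    assume f: "f \<in> Xstar_space h" and \<phi>: "\<phi> \<in> X_space h"
    have "norm (stieltjes_sum f \<phi> p) \<le> Xstar_norm h f * X_norm h \<phi>"
      if p: "p tagged_division_of {0..h}" for p
    proof -
      have "norm (stieltjes_sum f \<phi> p) \<le> (\<Sum>(x, K)\<in>p. norm (f (Sup K) - f (Inf K)) * X_norm h \<phi>)"
        unfolding stieltjes_sum_def
      proof (rule sum_norm_le, clarify)
        fix x K assume "(x, K) \<in> p"
        from tagged_division_member[OF p this] have "- x \<in> {-h..0}" by auto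
        from norm_le_X_norm[OF \<phi> this]
        show "norm (row_mult (f (Sup K) - f (Inf K)) (\<phi> (- x))) \<le> norm (f (Sup K) - f (Inf K)) * X_norm h \<phi>"
          by (intro order_trans[OF norm_row_mult_le] mult_left_mono) auto
      qed
      also have "\<dots> = (\<Sum>(x, K)\<in>p. norm (f (Sup K) - f (Inf K))) * X_norm h \<phi>"
        by (simp add: case_prod_unfold sum_distrib_right)
      also have "\<dots> \<le> Xstar_norm h f * X_norm h \<phi>"
        using sum_increments_le[OF less_imp_le[OF h] increments_le_Xstar[OF f] p]
          total_variation_le_Xstar_norm[OF less_imp_le[OF h] f] X.nonneg[OF \<phi>]
        by (intro mult_right_mono) auto
      finally show ?thesis .
    qed
    note bnd = this
    have "eventually (\<lambda>p. norm (stieltjes_sum f \<phi> p) \<le> Xstar_norm h f * X_norm h \<phi>) (mesh_filter h)"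
      by (rule eventually_mono[OF eventually_tagged_division bnd])
    then show "cmod (Xstar_pairing h f \<phi>) \<le> Xstar_norm h f * X_norm h \<phi>"
      by (rule tendsto_upperbound[OF tendsto_norm[OF lim[OF f \<phi>]]]) simp
  qed
qed

text \<open>
  The unit jump at \<open>s\<close> represents the point evaluation at \<open>-s\<close>. The condition \<open>0 < \<theta>\<close> normalises the value at \<open>0\<close>,
  so that a jump at \<open>s = 0\<close> is also covered, while right continuity persists at every positive point.
\<close>

definition jump :: "real \<Rightarrow> real \<Rightarrow> real" where
  "jump s \<theta> = of_bool (0 < \<theta> \<and> s \<le> \<theta>)"

lemma increments_le_jump: "increments_le h (\<lambda>\<theta>. jump s \<theta> *\<^sub>R axis i (1::complex) :: complex ^ 'n) (jump s)"
  by (auto simp: increments_le_def jump_def norm_axis_1 scaleR_left_diff_distrib[symmetric])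

lemma jump_in_Xstar:
  assumes h: "0 < h"
  shows "(\<lambda>\<theta>. jump s \<theta> *\<^sub>R axis i (1::complex) :: complex ^ 'n) \<in> Xstar_space h" (is "?f \<in> _")
proof -
  have "bdd_above (variation_sums 0 h ?f)"
    unfolding bdd_above_def variation_sums_def
    using division_sum_increments_le[OF less_imp_le[OF h] increments_le_jump] by blast
  moreover have "continuous (at_right \<theta>) ?f" if "\<theta> > 0" for \<theta>
  proof -
    have "eventually (\<lambda>x. jump s x = jump s \<theta>) (at_right \<theta>)"
    proof (cases "s \<le> \<theta>")
      case True
      then show ?thesis using that
        by (intro eventually_at_rightI[of \<theta> "\<theta> + 1"]) (auto simp: jump_def)
    next
      case False
      then show ?thesis
        by (intro eventually_at_rightI[of \<theta> s]) (auto simp: jump_def)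
    qed
    then have "eventually (\<lambda>x. ?f x = ?f \<theta>) (at_right \<theta>)" by (rule eventually_mono) simp
    then show ?thesis
      unfolding continuous_within by (rule tendsto_eventually)
  qed
  ultimately show ?thesis by (simp add: Xstar_space_def jump_def)
qed

text \<open>
  Only intervals that contain \<open>s\<close> carry an increment, and the tags of these are close to \<open>s\<close>. The increments
  add up to one, so the sum is an average of values of \<open>\<phi>\<close> near \<open>-s\<close>.
\<close>

lemma Xstar_pairing_jump:
  assumes s: "0 \<le> s" "s \<le> h" and h: "0 < h" and \<phi>: "\<phi> \<in> X_space h"
  shows "Xstar_pairing h (\<lambda>\<theta>. jump s \<theta> *\<^sub>R axis i (1::complex)) \<phi> = \<phi> (- s) $ i"
proof (rule Xstar_pairing_eqI)
  let ?f = "\<lambda>\<theta>. jump s \<theta> *\<^sub>R axis i (1::complex)"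
  show "(stieltjes_sum ?f \<phi> \<longlongrightarrow> \<phi> (- s) $ i) (mesh_filter h)"
    unfolding tendsto_iff eventually_mesh_filter
  proof (intro allI impI)
    fix e :: real assume e: "e > 0"
    have "continuous_on {-h..0} \<phi>" using \<phi> by (simp add: X_space_def)
    moreover have "- s \<in> {-h..0}" using s by simp
    ultimately obtain d where d: "d > 0"
      and close: "\<And>x. x \<in> {-h..0} \<Longrightarrow> dist x (- s) < d \<Longrightarrow> dist (\<phi> x) (\<phi> (- s)) < e / 2"
      unfolding continuous_on_iff using e by (metis half_gt_zero)
    have "dist (stieltjes_sum ?f \<phi> p) (\<phi> (- s) $ i) < e"
      if p: "p tagged_division_of {0..h}" "(\<lambda>x. ball x d) fine p" for p
    proof -
      let ?J = "\<lambda>K. jump s (Sup K) - jump s (Inf K)"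
      have J: "(\<Sum>(x, K)\<in>p. ?J K) = 1"
        using additive_tagged_division_1[OF less_imp_le[OF h] p(1), of "jump s"] h s
        by (simp add: jump_def)
      then have "(\<Sum>(x, K)\<in>p. complex_of_real (?J K)) = 1"
        by (metis (mono_tags, lifting) of_real_1 of_real_sum case_prod_unfold sum.cong)
      moreover have "stieltjes_sum ?f \<phi> p = (\<Sum>(x, K)\<in>p. complex_of_real (?J K) * \<phi> (- x) $ i)"
        unfolding stieltjes_sum_def scaleR_left_diff_distrib[symmetric]
        by (simp only: row_mult_scaleR row_mult_axis)
      ultimately have "stieltjes_sum ?f \<phi> p - \<phi> (- s) $ i
          = (\<Sum>(x, K)\<in>p. complex_of_real (?J K) * \<phi> (- x) $ i)
            - (\<Sum>(x, K)\<in>p. complex_of_real (?J K)) * \<phi> (- s) $ i"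
        by simp
      also have "\<dots> = (\<Sum>(x, K)\<in>p. complex_of_real (?J K) * ((\<phi> (- x) - \<phi> (- s)) $ i))"
        unfolding sum_distrib_right sum_subtractf[symmetric]
        by (intro sum.cong refl) (simp only: case_prod_unfold right_diff_distrib vector_minus_component)
      also have "norm \<dots> \<le> (\<Sum>(x, K)\<in>p. ?J K * (e / 2))"
      proof (rule sum_norm_le, clarify)
        fix x K assume xK: "(x, K) \<in> p"
        note K = tagged_division_member[OF p(1) xK]
        show "norm (of_real (?J K) * ((\<phi> (- x) - \<phi> (- s)) $ i)) \<le> ?J K * (e / 2)"
        proof (cases "?J K = 0")
          case False
          then have "s \<in> {Inf K..Sup K}" and J1: "?J K = 1"
            using K(2-6) s by (auto simp: jump_def of_bool_def split: if_splits)
          then have "s \<in> ball x d" using fineD[OF p(2) xK] K(1) by auto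
          then have "norm (\<phi> (- x) - \<phi> (- s)) < e / 2"
            using close[of "- x"] K(2-5) by (auto simp: dist_norm dist_commute abs_minus_commute)
          then show ?thesis
            unfolding J1 using Finite_Cartesian_Product.norm_nth_le[of "\<phi> (- x) - \<phi> (- s)" i] by simp
        qed simp
      qed
      also have "\<dots> = e / 2"
        using J by (simp add: case_prod_unfold sum_divide_distrib[symmetric] sum_distrib_right[symmetric])
      finally show ?thesis using e by (simp add: dist_norm)
    qed
    then show "\<exists>d>0. \<forall>p. p tagged_division_of {0..h} \<and> (\<lambda>x. ball x d) fine p \<longrightarrow>
        dist (stieltjes_sum ?f \<phi> p) (\<phi> (- s) $ i) < e"
      using d by blast
  qed
qed

lemma X_separated:
  fixes \<phi> :: "real \<Rightarrow> complex ^ 'n"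
  assumes h: "0 < h" and \<phi>: "\<phi> \<in> X_space h"
    and ann: "\<And>f. f \<in> Xstar_space h \<Longrightarrow> Xstar_pairing h f \<phi> = 0"
  shows "X_norm h \<phi> = 0"
proof -
  have "\<phi> \<theta> = 0" if "\<theta> \<in> {-h..0}" for \<theta>
    using Xstar_pairing_jump[of "- \<theta>" h \<phi>] ann[OF jump_in_Xstar[OF h]] that h \<phi>
    by (auto simp: vec_eq_iff)
  then have "X_norm h \<phi> \<le> 0" using h by (intro X_norm_leI) auto
  then show ?thesis
    using seminormed_space.nonneg[OF seminormed_space_X[OF h] \<phi>] by simp
qed

section \<open>Separation by continuous functions\<close>

lemma tagged_division_of_increasing:
  fixes x :: "nat \<Rightarrow> real"
  assumes "strict_mono x"
  shows "(\<lambda>k. (x k, {x k..x (Suc k)})) ` {..<Suc N} tagged_division_of {x 0..x (Suc N)}"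
proof (induction N)
  case 0
  have "x 0 \<le> x (Suc 0)" using assms by (simp add: strict_mono_less_eq)
  then show ?case
    using tagged_division_of_self[of "x 0" "x 0" "x (Suc 0)"] by (simp add: lessThan_Suc)
next
  case (Suc N)
  let ?n = "Suc N"
  have le: "x 0 \<le> x ?n" "x ?n \<le> x (Suc ?n)" using assms by (auto simp: strict_mono_less_eq)
  then have "{(x ?n, {x ?n..x (Suc ?n)})} tagged_division_of {x ?n..x (Suc ?n)}"
    using tagged_division_of_self[of "x ?n" "x ?n" "x (Suc ?n)"] by simp
  from tagged_division_Un[OF Suc this]
  have "(\<lambda>k. (x k, {x k..x (Suc k)})) ` {..<?n} \<union> {(x ?n, {x ?n..x (Suc ?n)})}
      tagged_division_of {x 0..x ?n} \<union> {x ?n..x (Suc ?n)}" by simp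
  moreover have "{x 0..x ?n} \<union> {x ?n..x (Suc ?n)} = {x 0..x (Suc ?n)}" using le by auto
  ultimately show ?case by (simp add: lessThan_Suc)
qed

lemma sum_by_parts:
  fixes F A :: "nat \<Rightarrow> complex"
  shows "(\<Sum>k<N. (F (Suc k) - F k) * A k) = F N * A N - F 0 * A 0 + (\<Sum>k<N. F (Suc k) * (A k - A (Suc k)))"
  by (induction N) (simp_all add: algebra_simps)

text \<open>
  Pairing with constants gives \<open>f h = 0\<close>. In the interior, \<open>f s\<close> is recovered from ramps that equal one up to
  \<open>s\<close> and fall to zero just after it: summation by parts turns the Stieltjes sum into an average of
  values of \<open>f\<close> slightly to the right of \<open>s\<close>, with the decrements of the ramp as weights. Right continuity
  makes this average close to \<open>f s\<close>, while the annihilation hypothesis makes it close to zero.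
\<close>

lemma Xstar_separated:
  fixes f :: "real \<Rightarrow> complex ^ 'n"
  assumes h: "0 < h" and f: "f \<in> Xstar_space h"
    and ann: "\<And>\<phi>. \<phi> \<in> X_space h \<Longrightarrow> Xstar_pairing h f \<phi> = 0"
  shows "Xstar_norm h f = 0"
proof -
  note lim = tendsto_Xstar_pairing[OF less_imp_le[OF h] f]
  have f0: "f 0 = 0" using f by (simp add: Xstar_space_def)
  have fh: "f h $ i = 0" for i
  proof -
    let ?\<phi> = "\<lambda>_. axis i 1 :: complex ^ 'n"
    have "?\<phi> \<in> X_space h" by (simp add: X_space_def)
    from lim[OF this] ann[OF this] have "(stieltjes_sum f ?\<phi> \<longlongrightarrow> 0) (mesh_filter h)" by simp
    moreover have "eventually (\<lambda>p. stieltjes_sum f ?\<phi> p = f h $ i) (mesh_filter h)"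
    proof (rule eventually_mono[OF eventually_tagged_division])
      fix p assume "p tagged_division_of {0..h}"
      from additive_tagged_division_1[OF less_imp_le[OF h] this, of "\<lambda>\<theta>. f \<theta> $ i"]
      show "stieltjes_sum f ?\<phi> p = f h $ i" by (simp add: stieltjes_sum_def f0)
    qed
    then have "(stieltjes_sum f ?\<phi> \<longlongrightarrow> f h $ i) (mesh_filter h)" by (rule tendsto_eventually)
    ultimately show ?thesis using tendsto_unique[OF mesh_filter_nontrivial] by blast
  qed
  have fs: "f s $ i = 0" if s: "0 < s" "s < h" for s i
  proof (rule ccontr)
    assume nz: "f s $ i \<noteq> 0"
    define e where "e = norm (f s $ i) / 2"
    have e: "e > 0" using nz by (simp add: e_def)
    have "continuous (at_right s) f" using f s by (simp add: Xstar_space_def)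
    then have "((\<lambda>\<theta>. f \<theta> $ i) \<longlongrightarrow> f s $ i) (at_right s)"
      unfolding continuous_within by (rule tendsto_vec_nth)
    then have "eventually (\<lambda>\<theta>. dist (f \<theta> $ i) (f s $ i) < e) (at_right s)"
      using e by (simp add: tendsto_iff)
    then obtain b where b: "b > s" and near: "\<And>\<theta>. s < \<theta> \<Longrightarrow> \<theta> < b \<Longrightarrow> norm (f \<theta> $ i - f s $ i) < e"
      unfolding eventually_at_right[OF s(2)] by (auto simp: dist_norm)
    \<comment> \<open>The factor 2 leaves room for one mesh length beyond the ramp.\<close>
    define \<delta> where "\<delta> = (min b h - s) / 2"
    have \<delta>: "\<delta> > 0" "s + 2 * \<delta> \<le> b" "s + \<delta> \<le> h" using b s by (auto simp: \<delta>_def min_def field_simps)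
    \<comment> \<open>The ramp: one up to \<open>s\<close>, zero from \<open>s + \<delta>\<close> on, and linear in between.\<close>
    define A where "A \<theta> = max 0 (min 1 (1 - (\<theta> - s) / \<delta>))" for \<theta>
    define \<phi> :: "real \<Rightarrow> complex ^ 'n" where "\<phi> \<theta> = A (- \<theta>) *\<^sub>R axis i 1" for \<theta>
    have \<phi>_mem: "\<phi> \<in> X_space h"
      unfolding X_space_def \<phi>_def A_def using \<delta>(1) by (auto intro!: continuous_intros)
    have "(stieltjes_sum f \<phi> \<longlongrightarrow> 0) (mesh_filter h)"
      using lim[OF \<phi>_mem] ann[OF \<phi>_mem] by simp
    then obtain d where d: "d > 0" and small:
      "\<And>p. p tagged_division_of {0..h} \<Longrightarrow> (\<lambda>x. ball x d) fine p \<Longrightarrow> norm (stieltjes_sum f \<phi> p) < e"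
      unfolding tendsto_iff eventually_mesh_filter using e by auto
    obtain N where N: "inverse (real (Suc N)) < min d \<delta> / h"
      using reals_Archimedean[of "min d \<delta> / h"] d \<delta> h by auto
    define x where "x k = real k * (h / real (Suc N))" for k
    have "inverse (real (Suc N)) * h < min d \<delta>"
      using N h by (simp only: pos_less_divide_eq)
    then have mesh: "h / real (Suc N) < d" "h / real (Suc N) < \<delta>"
      by (simp_all add: divide_inverse mult.commute)
    have x_step: "x (Suc k) = x k + h / real (Suc N)" for k
      by (simp add: x_def distrib_right add.commute add_divide_distrib)
    have x_mono: "strict_mono x"
      using h by (simp add: strict_mono_Suc_iff x_step)
    have x_ends: "x 0 = 0" "x (Suc N) = h" by (simp_all add: x_def)
    let ?p = "(\<lambda>k. (x k, {x k..x (Suc k)})) ` {..<Suc N}"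
    have tag: "?p tagged_division_of {0..h}"
      using tagged_division_of_increasing[OF x_mono, of N] unfolding x_ends .
    have fine: "(\<lambda>x. ball x d) fine ?p"
      using mesh(1) by (auto simp: fine_def dist_real_def x_step)
    have A_anti: "A b \<le> A a" if "a \<le> b" for a b
    proof -
      have "(a - s) / \<delta> \<le> (b - s) / \<delta>" using that \<delta>(1) by (simp add: divide_right_mono)
      then show ?thesis by (auto simp: A_def)
    qed
    have A_one: "A \<theta> = 1" if "\<theta> \<le> s" for \<theta>
    proof -
      have "(\<theta> - s) / \<delta> \<le> 0" using that \<delta>(1) by (simp add: divide_le_0_iff)
      then show ?thesis by (simp add: A_def)
    qed
    have A_zero: "A \<theta> = 0" if "s + \<delta> \<le> \<theta>" for \<theta>
    proof -
      have "1 \<le> (\<theta> - s) / \<delta>" using that \<delta>(1) by (simp add: le_divide_eq)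
      then show ?thesis by (simp add: A_def)
    qed
    have A_ends: "A 0 = 1" "A h = 0"
      using s(1) \<delta>(3) by (simp_all add: A_one A_zero)
    let ?D = "\<lambda>k. A (x k) - A (x (Suc k))"
    have inj: "inj_on (\<lambda>k. (x k, {x k..x (Suc k)})) {..<Suc N}"
      using strict_mono_eq[OF x_mono] by (auto simp: inj_on_def)
    have "stieltjes_sum f \<phi> ?p = (\<Sum>k<Suc N. (f (x (Suc k)) $ i - f (x k) $ i) * of_real (A (x k)))"
      unfolding stieltjes_sum_def
      using strict_mono_less_eq[OF x_mono]
      by (subst sum.reindex[OF inj], intro sum.cong)
        (auto simp: \<phi>_def row_mult_scaleR mult.commute)
    also have "\<dots> = (\<Sum>k<Suc N. f (x (Suc k)) $ i * of_real (?D k))"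
      using sum_by_parts[of "\<lambda>k. f (x k) $ i" "\<lambda>k. of_real (A (x k))" "Suc N"]
      unfolding x_ends A_ends f0 of_real_diff by simp
    finally have S: "stieltjes_sum f \<phi> ?p = (\<Sum>k<Suc N. f (x (Suc k)) $ i * of_real (?D k))" .
    have D_sum: "(\<Sum>k<Suc N. ?D k) = 1"
      using sum_lessThan_telescope'[of "\<lambda>k. A (x k)" "Suc N"] unfolding x_ends A_ends by simp
    have "stieltjes_sum f \<phi> ?p - f s $ i
        = stieltjes_sum f \<phi> ?p - f s $ i * of_real (\<Sum>k<Suc N. ?D k)"
      unfolding D_sum by simp
    also have "\<dots> = (\<Sum>k<Suc N. (f (x (Suc k)) $ i - f s $ i) * of_real (?D k))"
      unfolding S of_real_sum sum_distrib_left left_diff_distrib by (rule sum_subtractf[symmetric])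
    also have "norm \<dots> \<le> (\<Sum>k<Suc N. e * ?D k)"
    proof (rule sum_norm_le)
      fix k assume "k \<in> {..<Suc N}"
      have D0: "0 \<le> ?D k" using A_anti[of "x k" "x (Suc k)"] h by (simp add: x_step)
      show "norm ((f (x (Suc k)) $ i - f s $ i) * of_real (?D k)) \<le> e * ?D k"
      proof (cases "s < x (Suc k) \<and> x k < s + \<delta>")
        case True
        then have "norm (f (x (Suc k)) $ i - f s $ i) < e"
          using mesh(2) \<delta> by (intro near) (auto simp: x_step)
        then show ?thesis using D0 by (simp add: norm_mult mult_right_mono del: of_real_diff)
      next
        case False
        moreover have "x k \<le> x (Suc k)" using h by (simp add: x_step)
        ultimately have "?D k = 0" by (auto simp: A_one A_zero not_less)
        then show ?thesis by simp
      qed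
    qed
    also have "\<dots> = e" using D_sum by (simp add: sum_distrib_left[symmetric] del: sum.lessThan_Suc)
    finally have "norm (stieltjes_sum f \<phi> ?p - f s $ i) \<le> e" .
    moreover have "norm (stieltjes_sum f \<phi> ?p) < e" by (rule small[OF tag fine])
    ultimately have "norm (f s $ i) < 2 * e"
      using norm_triangle_ineq2[of "f s $ i" "stieltjes_sum f \<phi> ?p"] by (simp add: norm_minus_commute)
    then show False by (simp add: e_def)
  qed
  have zero: "f \<theta> = 0" if "0 \<le> \<theta>" "\<theta> \<le> h" for \<theta>
    using f0 fh fs that by (cases "\<theta> = 0"; cases "\<theta> = h") (auto simp: vec_eq_iff)
  have "increments_le h f (\<lambda>_. 0)" using zero by (simp add: increments_le_def)
  from division_sum_increments_le[OF less_imp_le[OF h] this]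
  have "Xstar_norm h f \<le> 0" using h by (intro Xstar_norm_leI) auto
  then show ?thesis using Xstar_norm_nonneg[OF less_imp_le[OF h] f] by simp
qed

section \<open>Nondegeneracy of the periodic pairings\<close>

theorem lemma3p22:
  fixes h T :: real
  assumes "0 < h" and "0 < T"
  shows "let
      CX = (C_per T (X_space h) (X_norm h) :: (real \<Rightarrow> real \<Rightarrow> complex ^ 'n) set);
      CXstar = (C_per T (Xstar_space h) (Xstar_norm h) :: (real \<Rightarrow> real \<Rightarrow> complex ^ 'n) set);
      CXsun = (C_per T (Xsun_space h) (Xsun_norm h)
        :: (real \<Rightarrow> (complex ^ 'n) \<times> (real \<Rightarrow> complex ^ 'n)) set);
      CXsunstar = (C_per T (Xsunstar_space h) (Xsunstar_norm h)
        :: (real \<Rightarrow> (complex ^ 'n) \<times> (real \<Rightarrow> complex ^ 'n)) set)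
    in
      bilinear_form_on CXstar CX (pairing_T T (Xstar_pairing h)) \<and>
      nondegenerate_on CXstar (same_fun (Xstar_norm h)) CX (same_fun (X_norm h))
        (pairing_T T (Xstar_pairing h)) \<and>
      bilinear_form_on CXsunstar CXsun (pairing_T T (Xsunstar_pairing h)) \<and>
      nondegenerate_on CXsunstar (same_fun (Xsunstar_norm h)) CXsun (same_fun (Xsun_norm h))
        (pairing_T T (Xsunstar_pairing h))"
proof -
  note h = assms(1) and T = assms(2)
  interpret D: bounded_pairing "Xstar_space h :: (real \<Rightarrow> complex ^ 'n) set" "Xstar_norm h"
    "X_space h" "X_norm h" "Xstar_pairing h"
    by (rule bounded_pairing_Xstar[OF h])
  interpret S: bounded_pairing "Xsunstar_space h :: ((complex ^ 'n) \<times> _) set" "Xsunstar_norm h"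
    "Xsun_space h" "Xsun_norm h" "Xsunstar_pairing h"
    by (rule bounded_pairing_Xsunstar[OF h])
  show ?thesis
    unfolding Let_def
    using D.bilinear_pairing_T S.bilinear_pairing_T
      D.nondegenerate_pairing_T[OF T Xstar_separated[OF h] X_separated[OF h]]
      S.nondegenerate_pairing_T[OF T Xsunstar_separated[OF h] Xsun_separated[OF h]]
    by blast
qed

end
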